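(* Let $f:[\mathbb N]^2\to\mathbb N$ be addition-like. Then there is a computable instance $c:\mathbb N\to\{0,1\}$ of $\mathrm{RT}^f_2$ with no $\Sigma^0_2$ solution.
   Context: $[S]^2$ denotes the set of $2$-element subsets of $S$. A function $f:[\mathbb N]^2\to\mathbb N$ is addition-like if (1) $f$ is computable; (2) there is a computable function $g$ such that if $y>g(x,n)$ (and $y\neq x$) then $f(\{x,y\})>n$; and (3) there is a number $b$ such that for all $x\neq y$ there are at most $b$ many $z$ (with $z \neq x$) for which $f(\{x,z\})=f(\{x,y\})$. For $f:[\mathbb N]^2\to\mathbb N$, $\mathrm{RT}^f_2$ is the statement: for every $c:\mathbb N\to\{0,1\}$ (an instance) there is an infinite set $H\subseteq\mathbb N$ (a solution to $c$) such that $c(f(s))=c(f(t))$ for all $s,t\in[H]^2$. *)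

theory Defs
  imports "HOL-Library.Ramsey"
begin

text \<open>
  The total recursive functions of each arity \<open>n\<close>: those obtained from zero, successor and the
  projections by composition, primitive recursion and minimization, where minimization is
  applied only to regular functions (a zero always exists), so that everything stays total.
  An \<open>n\<close>-ary function is an operation on lists; only its values on lists of length \<open>n\<close> are
  meaningful.
\<close>

inductive total_recursive :: "nat \<Rightarrow> (nat list \<Rightarrow> nat) \<Rightarrow> bool" where
  zero: "total_recursive n (\<lambda>xs. 0)"
| succ: "total_recursive 1 (\<lambda>xs. Suc (xs ! 0))"
| proj: "i < n \<Longrightarrow> total_recursive n (\<lambda>xs. xs ! i)"
| comp: "total_recursive m g \<Longrightarrow> (\<And>i. i < m \<Longrightarrow> total_recursive n (h i)) \<Longrightarrow>
    total_recursive n (\<lambda>xs. g (map (\<lambda>i. h i xs) [0..<m]))"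
| prim_rec: "total_recursive n g \<Longrightarrow> total_recursive (Suc (Suc n)) h \<Longrightarrow>
    total_recursive (Suc n)
      (\<lambda>xs. rec_nat (g (tl xs)) (\<lambda>k r. h (k # r # tl xs)) (hd xs))"
| minimize: "total_recursive (Suc n) g \<Longrightarrow>
    (\<And>xs. length xs = n \<Longrightarrow> \<exists>y. g (y # xs) = 0) \<Longrightarrow>
    total_recursive n (\<lambda>xs. LEAST y. g (y # xs) = 0)"

definition computable1 :: "(nat \<Rightarrow> nat) \<Rightarrow> bool" where
  "computable1 c \<longleftrightarrow> (\<exists>F. total_recursive 1 F \<and> (\<forall>x. F [x] = c x))"

definition computable2 :: "(nat \<Rightarrow> nat \<Rightarrow> nat) \<Rightarrow> bool" where
  "computable2 g \<longleftrightarrow> (\<exists>F. total_recursive 2 F \<and> (\<forall>x y. F [x, y] = g x y))"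

definition computable_rel3 :: "(nat \<Rightarrow> nat \<Rightarrow> nat \<Rightarrow> bool) \<Rightarrow> bool" where
  "computable_rel3 R \<longleftrightarrow>
    (\<exists>F. total_recursive 3 F \<and> (\<forall>x y z. F [x, y, z] = (if R x y z then 1 else 0)))"

definition Sigma02 :: "nat set \<Rightarrow> bool" where
  "Sigma02 A \<longleftrightarrow> (\<exists>R. computable_rel3 R \<and> A = {x. \<exists>a. \<forall>b. R x a b})"

text \<open>
  A function on the 2-element sets \<open>[UNIV]\<^bsup>2\<^esup>\<close> is a function on \<open>nat set\<close> of which only the values on
  2-element sets matter. It is computable if \<open>f {x, y}\<close> is computable from \<open>x \<noteq> y\<close>; since
  inequality is decidable, the value of the binary function on the diagonal is irrelevant.
\<close>

definition computable_on_pairs :: "(nat set \<Rightarrow> nat) \<Rightarrow> bool" where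
  "computable_on_pairs f \<longleftrightarrow> (\<exists>F. computable2 F \<and> (\<forall>x y. x \<noteq> y \<longrightarrow> F x y = f {x, y}))"

definition addition_like :: "(nat set \<Rightarrow> nat) \<Rightarrow> bool" where
  "addition_like f \<longleftrightarrow>
    computable_on_pairs f \<and>
    (\<exists>g. computable2 g \<and> (\<forall>x n y. y > g x n \<and> y \<noteq> x \<longrightarrow> f {x, y} > n)) \<and>
    (\<exists>b. \<forall>x y. x \<noteq> y \<longrightarrow>
      finite {z. z \<noteq> x \<and> f {x, z} = f {x, y}} \<and> card {z. z \<noteq> x \<and> f {x, z} = f {x, y}} \<le> b)"

definition RT2_instance :: "(nat \<Rightarrow> nat) \<Rightarrow> bool" where
  "RT2_instance c \<longleftrightarrow> range c \<subseteq> {0, 1}"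

definition RT2_solution :: "(nat set \<Rightarrow> nat) \<Rightarrow> (nat \<Rightarrow> nat) \<Rightarrow> nat set \<Rightarrow> bool" where
  "RT2_solution f c H \<longleftrightarrow>
    infinite H \<and> (\<forall>s \<in> [H]\<^bsup>2\<^esup>. \<forall>t \<in> [H]\<^bsup>2\<^esup>. c (f s) = c (f t))"

end

(* Suppose a finite set D is contained in a solution H. For every y in H outside D, the clause
   {f{x,y} | x in D} is then monochromatic. So it suffices to colour computably in such a way
   that, for every infinite Sigma^0_2 set H_e, there is a finite D_e contained in H_e all of whose
   clauses, for y large, are two-coloured. The sets D_e are approximated in the limit, each as the
   least candidate that has not been refuted so far; a change of candidate is delayed so
   that clauses of different candidates for D_e are disjoint. Addition-likeness then makes the clauses
   of index e long (at least |D_e|/b) while each number lies in at most b|D_e| of them, which is the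
   situation of the Lovasz local lemma, with as much slack as one wants.

   The slack makes the computable version easy. Cut the natural numbers into consecutive finite
   layers so long that each clause meets at most two consecutive ones. Every clause has at least half
   of its elements in one layer, so the layers can be coloured independently of each other, each by
   a finite search whose success is guaranteed by the finite local lemma. *)

theory Submission
  imports Defs Complex_Main "HOL-Library.Nat_Bijection" "HOL-Library.FuncSet"
begin

section \<open>Closure properties of computable functions\<close>

text \<open>\<open>total_recursive\<close> also fixes the junk values on lists of the wrong length,
  so it is not invariant under rewriting a function. \<open>recfun\<close> keeps only the values on
  lists of length \<open>n\<close>.\<close>

definition recfun :: "nat \<Rightarrow> (nat list \<Rightarrow> nat) \<Rightarrow> bool" where
  "recfun n F \<longleftrightarrow> (\<exists>G. total_recursive n G \<and> (\<forall>xs. length xs = n \<longrightarrow> G xs = F xs))"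

lemma computable1_iff_recfun: "computable1 c \<longleftrightarrow> recfun 1 (\<lambda>xs. c (xs ! 0))"
proof
  assume "computable1 c"
  then obtain F where F: "total_recursive 1 F" "\<And>x. F [x] = c x"
    by (auto simp: computable1_def)
  have "\<forall>xs. length xs = 1 \<longrightarrow> F xs = c (xs ! 0)"
    using F(2) by (metis One_nat_def length_0_conv length_Suc_conv nth_Cons_0)
  with F(1) show "recfun 1 (\<lambda>xs. c (xs ! 0))" by (auto simp: recfun_def)
next
  assume "recfun 1 (\<lambda>xs. c (xs ! 0))"
  then show "computable1 c" by (force simp: recfun_def computable1_def)
qed

lemma computable2_iff_recfun: "computable2 h \<longleftrightarrow> recfun 2 (\<lambda>xs. h (xs ! 0) (xs ! 1))"
proof
  assume "computable2 h"
  then obtain F where F: "total_recursive 2 F" "\<And>x y. F [x, y] = h x y"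
    by (auto simp: computable2_def)
  have "F xs = h (xs ! 0) (xs ! 1)" if len: "length xs = 2" for xs
  proof -
    obtain x y where "xs = [x, y]"
      using len by (auto simp: numeral_2_eq_2 length_Suc_conv)
    then show ?thesis using F(2) by simp
  qed
  with F(1) show "recfun 2 (\<lambda>xs. h (xs ! 0) (xs ! 1))" by (auto simp: recfun_def)
next
  assume "recfun 2 (\<lambda>xs. h (xs ! 0) (xs ! 1))"
  then show "computable2 h" by (force simp: recfun_def computable2_def)
qed

lemma recfun_comp:
  assumes "recfun m G" and "\<And>i. i < m \<Longrightarrow> recfun n (H i)"
  shows "recfun n (\<lambda>xs. G (map (\<lambda>i. H i xs) [0..<m]))"
proof -
  obtain G' where G': "total_recursive m G'" "\<And>xs. length xs = m \<Longrightarrow> G' xs = G xs"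
    using assms(1) by (auto simp: recfun_def)
  obtain H' where H': "\<And>i. i < m \<Longrightarrow> total_recursive n (H' i)"
    "\<And>i xs. i < m \<Longrightarrow> length xs = n \<Longrightarrow> H' i xs = H i xs"
    using assms(2) unfolding recfun_def by metis
  have "total_recursive n (\<lambda>xs. G' (map (\<lambda>i. H' i xs) [0..<m]))"
    using G'(1) H'(1) by (rule total_recursive.comp)
  moreover have "G' (map (\<lambda>i. H' i xs) [0..<m]) = G (map (\<lambda>i. H i xs) [0..<m])"
    if "length xs = n" for xs
    proof -
    have "map (\<lambda>i. H' i xs) [0..<m] = map (\<lambda>i. H i xs) [0..<m]"
      using that H'(2) by (intro map_cong) auto
    then have "G' (map (\<lambda>i. H' i xs) [0..<m]) = G' (map (\<lambda>i. H i xs) [0..<m])"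
      by (rule arg_cong)
    also have "\<dots> = G (map (\<lambda>i. H i xs) [0..<m])" by (rule G'(2)) simp
    finally show ?thesis .
  qed
  ultimately show ?thesis by (auto simp: recfun_def)
qed

lemma recfun_cong: "recfun n F \<Longrightarrow> (\<And>xs. length xs = n \<Longrightarrow> F xs = G xs) \<Longrightarrow> recfun n G"
  by (auto simp: recfun_def)

lemma recfun_proj: "i < n \<Longrightarrow> recfun n (\<lambda>xs. xs ! i)"
  unfolding recfun_def using total_recursive.proj by blast

lemma recfun_app1: "computable1 h \<Longrightarrow> recfun n F \<Longrightarrow> recfun n (\<lambda>xs. h (F xs))"
  using recfun_comp[of 1 "\<lambda>xs. h (xs ! 0)" n "\<lambda>_. F"] by (simp add: computable1_iff_recfun)

lemma recfun_app2: "computable2 h \<Longrightarrow> recfun n F \<Longrightarrow> recfun n G \<Longrightarrow> recfun n (\<lambda>xs. h (F xs) (G xs))"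
  using recfun_comp[of 2 "\<lambda>xs. h (xs ! 0) (xs ! 1)" n "\<lambda>i. if i = 0 then F else G"]
  by (simp add: computable2_iff_recfun)

lemma recfun_const: "recfun n (\<lambda>xs. k)"
proof (induction k)
  case 0
  then show ?case unfolding recfun_def using total_recursive.zero by blast
next
  case (Suc k)
  have "computable1 Suc"
    unfolding computable1_def using total_recursive.succ by force
  from recfun_app1[OF this Suc] show ?case .
qed

text \<open>The basic scheme recurses on the head of its argument list; composing it with
  \<open>B xs # xs\<close> allows a computed bound while the parameters \<open>xs\<close> stay
  available.\<close>

lemma recfun_rec:
  assumes "recfun n G" "recfun (Suc (Suc n)) H" "recfun n B"
  shows "recfun n (\<lambda>xs. rec_nat (G xs) (\<lambda>k r. H (k # r # xs)) (B xs))"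
proof -
  obtain G' where G': "total_recursive n G'" "\<And>xs. length xs = n \<Longrightarrow> G' xs = G xs"
    using assms(1) by (auto simp: recfun_def)
  obtain H' where H': "total_recursive (Suc (Suc n)) H'"
    "\<And>xs. length xs = Suc (Suc n) \<Longrightarrow> H' xs = H xs"
    using assms(2) by (auto simp: recfun_def)
  have "recfun (Suc n) (\<lambda>xs. rec_nat (G' (tl xs)) (\<lambda>k r. H' (k # r # tl xs)) (hd xs))"
    unfolding recfun_def using total_recursive.prim_rec[OF G'(1) H'(1)] by blast
  moreover have "recfun n (\<lambda>xs. if i = 0 then B xs else xs ! (i - 1))" if "i < Suc n" for i
    using that assms(3) by (cases i) (auto intro: recfun_proj)
  ultimately have "recfun n (\<lambda>xs. (\<lambda>ys. rec_nat (G' (tl ys)) (\<lambda>k r. H' (k # r # tl ys)) (hd ys))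
      (map (\<lambda>i. if i = 0 then B xs else xs ! (i - 1)) [0..<Suc n]))"
    by (rule recfun_comp[where H = "\<lambda>i xs. if i = 0 then B xs else xs ! (i - 1)"])
  then show ?thesis
  proof (rule recfun_cong)
    fix xs :: "nat list" assume len: "length xs = n"
    have eq: "map (\<lambda>i. if i = 0 then B xs else xs ! (i - 1)) [0..<Suc n] = B xs # xs"
      using len by (auto intro!: nth_equalityI simp: nth_Cons' simp del: upt_Suc)
    have "rec_nat (G' xs) (\<lambda>k r. H' (k # r # xs)) m = rec_nat (G xs) (\<lambda>k r. H (k # r # xs)) m" for m
      using G'(2) H'(2) len by (induction m) auto
    then show "(\<lambda>ys. rec_nat (G' (tl ys)) (\<lambda>k r. H' (k # r # tl ys)) (hd ys))
        (map (\<lambda>i. if i = 0 then B xs else xs ! (i - 1)) [0..<Suc n])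
      = rec_nat (G xs) (\<lambda>k r. H (k # r # xs)) (B xs)"
      unfolding eq by simp
  qed
qed

lemma recfun_least:
  assumes "recfun (Suc n) P" "\<And>xs. length xs = n \<Longrightarrow> \<exists>y. P (y # xs) = 0"
  shows "recfun n (\<lambda>xs. LEAST y. P (y # xs) = 0)"
proof -
  obtain P' where P': "total_recursive (Suc n) P'" "\<And>xs. length xs = Suc n \<Longrightarrow> P' xs = P xs"
    using assms(1) by (auto simp: recfun_def)
  have "total_recursive n (\<lambda>xs. LEAST y. P' (y # xs) = 0)"
    using P'(1) by (rule total_recursive.minimize) (use P'(2) assms(2) in simp)
  then show ?thesis
    unfolding recfun_def using P'(2) by (intro exI[of _ "\<lambda>xs. LEAST y. P' (y # xs) = 0"]) simp
qed

section \<open>Basic arithmetic functions\<close>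

lemma computable1_comp: "computable1 h \<Longrightarrow> computable1 f \<Longrightarrow> computable1 (\<lambda>x. h (f x))"
  using recfun_app1 by (simp add: computable1_iff_recfun)

lemma computable2_comp:
  "computable2 h \<Longrightarrow> computable1 f \<Longrightarrow> computable1 g \<Longrightarrow> computable1 (\<lambda>x. h (f x) (g x))"
  using recfun_app2 by (simp add: computable1_iff_recfun)

lemma computable_const: "computable1 (\<lambda>x. k)"
  by (simp add: computable1_iff_recfun recfun_const)

lemma computable_id: "computable1 (\<lambda>x. x)"
  by (simp add: computable1_iff_recfun recfun_proj)

lemma computable1_Suc: "computable1 Suc"
  unfolding computable1_def using total_recursive.succ by force

lemma computable2_add: "computable2 (+)"
proof -
  have "recfun 2 (\<lambda>xs. rec_nat (xs ! 0) (\<lambda>k r. (\<lambda>ys. Suc (ys ! 1)) (k # r # xs)) (xs ! 1))"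
    by (intro recfun_rec recfun_app1[OF computable1_Suc] recfun_proj) auto
  moreover have "rec_nat a (\<lambda>k r. Suc r) b = a + b" for a b :: nat
    by (induction b) auto
  ultimately show ?thesis by (simp add: computable2_iff_recfun)
qed

lemma computable2_mult: "computable2 (*)"
proof -
  have "recfun 2 (\<lambda>xs. rec_nat 0 (\<lambda>k r. (\<lambda>ys. ys ! 1 + ys ! 2) (k # r # xs)) (xs ! 1))"
    by (intro recfun_rec recfun_app2[OF computable2_add] recfun_proj recfun_const) auto
  moreover have "rec_nat 0 (\<lambda>k r. r + a) b = a * b" for a b :: nat
    by (induction b) auto
  ultimately show ?thesis by (simp add: computable2_iff_recfun)
qed

lemma computable1_pred: "computable1 (\<lambda>x. x - 1)"
proof -
  have "recfun 1 (\<lambda>xs. rec_nat 0 (\<lambda>k r. (\<lambda>ys. ys ! 0) (k # r # xs)) (xs ! 0))"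
    by (intro recfun_rec recfun_proj recfun_const) auto
  moreover have "rec_nat 0 (\<lambda>k r. k) b = b - 1" for b :: nat
    by (cases b) auto
  ultimately show ?thesis by (simp add: computable1_iff_recfun)
qed

lemma computable2_diff: "computable2 (-)"
proof -
  have "recfun 2 (\<lambda>xs. rec_nat (xs ! 0) (\<lambda>k r. (\<lambda>ys. ys ! 1 - 1) (k # r # xs)) (xs ! 1))"
    by (intro recfun_rec recfun_app1[OF computable1_pred] recfun_proj) auto
  moreover have "rec_nat a (\<lambda>k r. r - 1) b = a - b" for a b :: nat
    by (induction b) auto
  ultimately show ?thesis by (simp add: computable2_iff_recfun)
qed

lemma computable1_triangle: "computable1 triangle"
proof -
  have "recfun 1 (\<lambda>xs. rec_nat 0 (\<lambda>k r. (\<lambda>ys. ys ! 1 + Suc (ys ! 0)) (k # r # xs)) (xs ! 0))"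
    by (intro recfun_rec recfun_app2[OF computable2_add] recfun_app1[OF computable1_Suc] recfun_proj recfun_const) auto
  moreover have "rec_nat 0 (\<lambda>k r. r + Suc k) b = triangle b" for b :: nat
    by (induction b) auto
  ultimately show ?thesis by (simp add: computable1_iff_recfun)
qed

section \<open>The Cantor pairing function and its projections\<close>

definition pr :: "nat \<Rightarrow> nat \<Rightarrow> nat" where "pr a b = prod_encode (a, b)"
definition p1 :: "nat \<Rightarrow> nat" where "p1 z = fst (prod_decode z)"
definition p2 :: "nat \<Rightarrow> nat" where "p2 z = snd (prod_decode z)"

lemma p1_pr [simp]: "p1 (pr a b) = a" and p2_pr [simp]: "p2 (pr a b) = b"
  by (simp_all add: p1_def p2_def pr_def)

lemma pr_p1_p2 [simp]: "pr (p1 z) (p2 z) = z"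
  by (simp add: p1_def p2_def pr_def)

lemma computable2_pr: "computable2 pr"
proof -
  have "recfun 2 (\<lambda>xs. triangle (xs ! 0 + xs ! 1) + xs ! 0)"
    by (intro recfun_app2[OF computable2_add] recfun_app1[OF computable1_triangle] recfun_proj) auto
  then show ?thesis by (simp add: computable2_iff_recfun pr_def prod_encode_def)
qed

text \<open>The diagonal \<open>a + b\<close> on which \<open>z = pr a b\<close> lies. Truncated
  subtraction turns the test \<open>z < triangle (Suc d)\<close> into a zero test, as minimization
  demands.\<close>

definition cantor_diag :: "nat \<Rightarrow> nat" where
  "cantor_diag z = (LEAST d. Suc z - triangle (Suc d) = 0)"

lemma computable1_cantor_diag: "computable1 cantor_diag"
proof -
  have *: "Suc z - triangle (Suc z) = 0" for z by simp
  have "recfun 1 (\<lambda>xs. LEAST d. (\<lambda>ys. Suc (ys ! 1) - triangle (Suc (ys ! 0))) (d # xs) = 0)"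
  proof (rule recfun_least)
    show "\<exists>d. Suc ((d # xs) ! 1) - triangle (Suc ((d # xs) ! 0)) = 0" for xs
      using *[of "xs ! 0"] by (intro exI[of _ "xs ! 0"]) simp
  qed (intro recfun_app2[OF computable2_diff] recfun_app1[OF computable1_triangle]
        recfun_app1[OF computable1_Suc] recfun_proj, auto)
  then show ?thesis by (simp add: computable1_iff_recfun cantor_diag_def)
qed

lemma mono_triangle: "a \<le> b \<Longrightarrow> triangle a \<le> triangle b"
  by (induction b rule: dec_induct) auto

lemma cantor_diag_pr: "cantor_diag (pr a b) = a + b"
  unfolding cantor_diag_def
proof (rule Least_equality)
  show "Suc (pr a b) - triangle (Suc (a + b)) = 0"
    by (simp add: pr_def prod_encode_def)
next
  fix d assume d: "Suc (pr a b) - triangle (Suc d) = 0"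
  show "a + b \<le> d"
  proof (rule ccontr)
    assume "\<not> a + b \<le> d"
    then have "triangle (Suc d) \<le> triangle (a + b)" by (intro mono_triangle) simp
    with d show False by (simp add: pr_def prod_encode_def)
  qed
qed

lemma p1_eq: "p1 z = z - triangle (cantor_diag z)"
proof -
  have "cantor_diag z = p1 z + p2 z"
    using cantor_diag_pr[of "p1 z" "p2 z"] by simp
  moreover have "triangle (p1 z + p2 z) + p1 z = z"
    using pr_p1_p2[of z] unfolding pr_def prod_encode_def by simp
  ultimately show ?thesis by (metis add_diff_cancel_left')
qed

lemma p2_eq: "p2 z = cantor_diag z - p1 z"
  using cantor_diag_pr[of "p1 z" "p2 z"] by simp

lemma computable1_p1: "computable1 p1"
  unfolding p1_eq[abs_def]
  by (intro computable2_comp[OF computable2_diff] computable1_comp[OF computable1_triangle]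
      computable1_cantor_diag computable_id)

lemma computable1_p2: "computable1 p2"
  unfolding p2_eq[abs_def]
  by (intro computable2_comp[OF computable2_diff] computable1_p1
      computable1_cantor_diag)

section \<open>Decidable predicates and closure rules for unary functions\<close>

definition decidable :: "(nat \<Rightarrow> bool) \<Rightarrow> bool" where
  "decidable P \<longleftrightarrow> computable1 (\<lambda>x. if P x then 1 else 0)"

named_theorems comp_intros

text \<open>The rules follow the syntax of a unary function. A body that also depends on a bound
  variable, as under \<open>LEAST\<close>, a sum or a bounded quantifier, is presented as a function
  of one coded pair.\<close>

lemmas [comp_intros] = computable_const computable_id
  computable1_comp[OF computable1_Suc]
  computable1_comp[OF computable1_p1]
  computable1_comp[OF computable1_p2]
  computable2_comp[OF computable2_add]
  computable2_comp[OF computable2_diff]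
  computable2_comp[OF computable2_mult]
  computable2_comp[OF computable2_pr]

lemma computable_rec [comp_intros]:
  assumes "computable1 g" "computable1 (\<lambda>p. h (p1 p) (p1 (p2 p)) (p2 (p2 p)))" "computable1 n"
  shows "computable1 (\<lambda>x. rec_nat (g x) (h x) (n x))"
proof -
  \<comment> \<open>\<open>recfun_rec\<close> hands over counter, previous value and parameter in
    this order, whereas the hypothesis on \<open>h\<close> codes the parameter first.\<close>
  have h: "computable1 (\<lambda>p. h (p2 (p2 p)) (p1 p) (p1 (p2 p)))"
    by (rule computable1_comp[OF assms(2), of "\<lambda>p. pr (p2 (p2 p)) (pr (p1 p) (p1 (p2 p)))",
        simplified p1_pr p2_pr]) (intro comp_intros)
  let ?H = "\<lambda>ys. pr (ys ! 0) (pr (ys ! 1) (ys ! 2))"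
  have "recfun 3 (\<lambda>ys. h (p2 (p2 (?H ys))) (p1 (?H ys)) (p1 (p2 (?H ys))))"
    by (intro recfun_app1[OF h] recfun_app2[OF computable2_pr] recfun_proj) auto
  then have H: "recfun (Suc (Suc 1)) (\<lambda>ys. h (ys ! 2) (ys ! 0) (ys ! 1))"
    by (simp add: numeral_3_eq_3)
  have "recfun 1 (\<lambda>xs. g (xs ! 0))" "recfun 1 (\<lambda>xs. n (xs ! 0))"
    using assms(1,3) by (simp_all add: computable1_iff_recfun)
  from recfun_rec[OF this(1) H this(2)]
  show ?thesis by (simp add: computable1_iff_recfun)
qed

lemma computable_if [comp_intros]:
  assumes "decidable P" "computable1 f" "computable1 g"
  shows "computable1 (\<lambda>x. if P x then f x else g x)"
proof -
  have "computable1 (\<lambda>x. (if P x then 1 else 0) * f x + (1 - (if P x then 1 else 0)) * g x)"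
    using assms(1) unfolding decidable_def by (intro comp_intros assms)
  moreover have "(\<lambda>x. (if P x then 1 else 0) * f x + (1 - (if P x then 1 else 0)) * g x) =
    (\<lambda>x. if P x then f x else g x)" by auto
  ultimately show ?thesis by simp
qed

lemma decidable_le [comp_intros]:
  assumes "computable1 f" "computable1 g"
  shows "decidable (\<lambda>x. f x \<le> g x)"
proof -
  have "computable1 (\<lambda>x. 1 - (f x - g x))"
    by (intro comp_intros assms)
  moreover have "(\<lambda>x. 1 - (f x - g x)) = (\<lambda>x. if f x \<le> g x then 1 else 0)" by auto
  ultimately show ?thesis by (simp add: decidable_def)
qed

lemma decidable_not [comp_intros]:
  assumes "decidable P" shows "decidable (\<lambda>x. \<not> P x)"
proof -
  have "computable1 (\<lambda>x. if P x then 0 else 1)"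
    by (intro comp_intros assms)
  moreover have "(\<lambda>x. if P x then 0 else 1) = (\<lambda>x. if \<not> P x then 1 else 0::nat)" by auto
  ultimately show ?thesis by (simp only: decidable_def)
qed

lemma decidable_conj [comp_intros]:
  assumes "decidable P" "decidable Q" shows "decidable (\<lambda>x. P x \<and> Q x)"
proof -
  have "computable1 (\<lambda>x. if P x then (if Q x then 1 else 0) else 0)"
    by (intro comp_intros assms)
  moreover have "(\<lambda>x. if P x then (if Q x then 1 else 0) else 0) = (\<lambda>x. if P x \<and> Q x then 1 else 0::nat)"
    by auto
  ultimately show ?thesis by (simp only: decidable_def)
qed

lemma decidable_disj [comp_intros]: "decidable P \<Longrightarrow> decidable Q \<Longrightarrow> decidable (\<lambda>x. P x \<or> Q x)"
  using decidable_not[OF decidable_conj[OF decidable_not[of P] decidable_not[of Q]]] by simp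

lemma decidable_imp [comp_intros]: "decidable P \<Longrightarrow> decidable Q \<Longrightarrow> decidable (\<lambda>x. P x \<longrightarrow> Q x)"
  using decidable_disj[OF decidable_not[of P], of Q] by (simp only: imp_conv_disj)

lemma decidable_less [comp_intros]: "computable1 f \<Longrightarrow> computable1 g \<Longrightarrow> decidable (\<lambda>x. f x < g x)"
  using decidable_not[OF decidable_le[of g f]] by (simp add: not_le)

lemma decidable_eq [comp_intros]: "computable1 f \<Longrightarrow> computable1 g \<Longrightarrow> decidable (\<lambda>x. f x = g x)"
  using decidable_conj[OF decidable_le[of f g] decidable_le[of g f]] by (simp add: eq_iff)

lemma decidable_comp: "decidable P \<Longrightarrow> computable1 f \<Longrightarrow> decidable (\<lambda>x. P (f x))"
  unfolding decidable_def by (rule computable1_comp)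

lemma computable_Least [comp_intros]:
  assumes "decidable (\<lambda>p. P (p1 p) (p2 p))" "\<And>x. \<exists>y. P x y"
  shows "computable1 (\<lambda>x. LEAST y. P x y)"
proof -
  have "decidable (\<lambda>p. \<not> P (p2 p) (p1 p))"
    by (rule decidable_not[OF decidable_comp[OF assms(1), of "\<lambda>p. pr (p2 p) (p1 p)"], simplified p1_pr p2_pr]) (intro comp_intros)
  then have c: "computable1 (\<lambda>p. if \<not> P (p2 p) (p1 p) then 1 else 0)"
    by (simp only: decidable_def)
  let ?H = "\<lambda>ys. pr (ys ! 0) (ys ! 1)"
  have "recfun 2 (\<lambda>ys. if \<not> P (p2 (?H ys)) (p1 (?H ys)) then 1 else 0)"
    by (intro recfun_app1[OF c] recfun_app2[OF computable2_pr] recfun_proj) auto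
  then have H: "recfun (Suc 1) (\<lambda>ys. if \<not> P (ys ! 1) (ys ! 0) then 1 else 0)"
    by (simp add: numeral_2_eq_2)
  have "recfun 1 (\<lambda>xs. LEAST y. (if \<not> P (xs ! 0) y then 1 else 0) = (0::nat))"
    using recfun_least[OF H] assms(2) by simp
  moreover have "((if \<not> P x y then 1 else 0) = (0::nat)) = P x y" for x y by simp
  ultimately show ?thesis by (simp only: computable1_iff_recfun)
qed

text \<open>Search for the least counterexample. Admitting every \<open>i \<ge> n x\<close> makes
  the search total, and the quantifier holds exactly when nothing is found below the bound.\<close>

lemma decidable_all [comp_intros]:
  assumes "decidable (\<lambda>p. P (p1 p) (p2 p))" "computable1 n"
  shows "decidable (\<lambda>x. \<forall>i<n x. P x i)"
proof -
  have "computable1 (\<lambda>x. LEAST i. i \<ge> n x \<or> \<not> P x i)"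
    by (intro comp_intros assms computable1_comp[OF assms(2)]) auto
  with assms(2) have "decidable (\<lambda>x. n x \<le> (LEAST i. i \<ge> n x \<or> \<not> P x i))"
    by (rule decidable_le)
  moreover have "(n x \<le> (LEAST i. i \<ge> n x \<or> \<not> P x i)) \<longleftrightarrow> (\<forall>i<n x. P x i)" for x
  proof
    assume "n x \<le> (LEAST i. i \<ge> n x \<or> \<not> P x i)"
    then show "\<forall>i<n x. P x i" using not_less_Least by (metis (no_types, lifting) order_less_le_trans)
  next
    assume *: "\<forall>i<n x. P x i"
    have "(LEAST i. i \<ge> n x \<or> \<not> P x i) \<ge> n x \<or> \<not> P x (LEAST i. i \<ge> n x \<or> \<not> P x i)"
      by (rule LeastI[of _ "n x"]) simp
    with * show "n x \<le> (LEAST i. i \<ge> n x \<or> \<not> P x i)" by (meson not_le)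
  qed
  ultimately show ?thesis by simp
qed

lemma decidable_ex [comp_intros]:
  "decidable (\<lambda>p. P (p1 p) (p2 p)) \<Longrightarrow> computable1 n \<Longrightarrow> decidable (\<lambda>x. \<exists>i<n x. P x i)"
  using decidable_not[OF decidable_all[OF decidable_not, of P n]] by simp

lemma computable_sum [comp_intros]:
  assumes "computable1 (\<lambda>p. t (p1 p) (p2 p))" "computable1 n"
  shows "computable1 (\<lambda>x. \<Sum>i<n x. t x i)"
proof -
  have t: "computable1 (\<lambda>p. t (p1 p) (p1 (p2 p)))"
    by (rule computable1_comp[OF assms(1), of "\<lambda>p. pr (p1 p) (p1 (p2 p))", simplified p1_pr p2_pr]) (intro comp_intros)
  have "computable1 (\<lambda>x. rec_nat 0 (\<lambda>k r. r + t x k) (n x))"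
    by (intro comp_intros t assms)
  moreover have "rec_nat 0 (\<lambda>k r. r + t x k) m = (\<Sum>i<m. t x i)" for x m
    by (induction m) auto
  ultimately show ?thesis by simp
qed

lemma computable_funpow [comp_intros]:
  assumes "computable1 h" "computable1 n" "computable1 f"
  shows "computable1 (\<lambda>x. (h ^^ n x) (f x))"
proof -
  have "computable1 (\<lambda>x. rec_nat (f x) (\<lambda>k r. h r) (n x))"
    by (intro comp_intros assms computable1_comp[OF assms(1)])
  moreover have "rec_nat a (\<lambda>k r. h r) m = (h ^^ m) a" for a m
    by (induction m) auto
  ultimately show ?thesis by simp
qed

text \<open>Lets a definition be unfolded once, on a coded pair, and then serve as a closure rule
  for arbitrary computable arguments.\<close>

lemma computable_curry2:
  assumes "computable1 (\<lambda>p. h (p1 p) (p2 p))" "computable1 f" "computable1 g"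
  shows "computable1 (\<lambda>x. h (f x) (g x))"
  by (rule computable1_comp[OF assms(1), of "\<lambda>x. pr (f x) (g x)", simplified p1_pr p2_pr]) (intro comp_intros assms)

lemma computable_curry3:
  assumes "computable1 (\<lambda>p. h (p1 p) (p1 (p2 p)) (p2 (p2 p)))"
    "computable1 f" "computable1 g" "computable1 k"
  shows "computable1 (\<lambda>x. h (f x) (g x) (k x))"
  by (rule computable1_comp[OF assms(1), of "\<lambda>x. pr (f x) (pr (g x) (k x))", simplified p1_pr p2_pr]) (intro comp_intros assms)

text \<open>Every number codes an infinite sequence, so no length is stored;
  \<open>ex_seq_nth\<close> allows any finite initial segment to be prescribed.\<close>

definition seq_nth :: "nat \<Rightarrow> nat \<Rightarrow> nat" where
  "seq_nth w i = p1 ((p2 ^^ i) w)"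

lemma computable_seq_nth [comp_intros]:
  "computable1 f \<Longrightarrow> computable1 g \<Longrightarrow> computable1 (\<lambda>x. seq_nth (f x) (g x))"
  unfolding seq_nth_def by (intro comp_intros computable1_p2)

lemma ex_seq_nth: "\<exists>w. \<forall>i<n. seq_nth w i = s i"
proof (induction n arbitrary: s)
  case (Suc n)
  obtain w where w: "\<forall>i<n. seq_nth w i = s (Suc i)" using Suc[of "\<lambda>i. s (Suc i)"] by auto
  have "seq_nth (pr (s 0) w) i = s i" if "i < Suc n" for i
    using that w by (cases i) (auto simp: seq_nth_def funpow_Suc_right simp del: funpow.simps(2))
  then show ?case by blast
qed simp

section \<open>A universal machine\<close>

definition eval_state :: "nat \<Rightarrow> nat \<Rightarrow> nat \<Rightarrow> nat" where
  "eval_state p x K = pr 0 (pr p (pr x K))"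

definition ret_state :: "nat \<Rightarrow> nat \<Rightarrow> nat" where
  "ret_state v K = pr 1 (pr v K)"

text \<open>\<open>Suc\<close> keeps every nonempty stack apart from the empty stack 0.\<close>

definition push :: "nat \<Rightarrow> nat \<Rightarrow> nat" where
  "push fr K = Suc (pr fr K)"

text \<open>
  A stack machine for unary partial recursive functions. Programs are coded as
  \<open>pr tag args\<close>, where the tags 0, ..., 7 stand for zero, successor, the two projections, pairing,
  composition, primitive recursion (on an input \<open>pr k x\<close>) and minimization. The third component of
  a state is the stack of pending frames: 0 and 4 wait for the first and second component of a
  pair, 1 for the inner function of a composition, 2 and 3 for one round of a primitive recursion
  or a minimization.
\<close>

definition step_eval :: "nat \<Rightarrow> nat \<Rightarrow> nat \<Rightarrow> nat" where
  "step_eval p x K =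
    (if p1 p = 0 then ret_state 0 K
     else if p1 p = 1 then ret_state (Suc x) K
     else if p1 p = 2 then ret_state (p1 x) K
     else if p1 p = 3 then ret_state (p2 x) K
     else if p1 p = 4 then eval_state (p1 (p2 p)) x (push (pr 0 (pr (p2 (p2 p)) x)) K)
     else if p1 p = 5 then eval_state (p2 (p2 p)) x (push (pr 1 (p1 (p2 p))) K)
     else if p1 p = 6 then
       eval_state (p1 (p2 p)) (p2 x) (push (pr 2 (pr (p2 (p2 p)) (pr (p1 x) (pr (p2 x) 0)))) K)
     else eval_state (p2 p) (pr 0 x) (push (pr 3 (pr (p2 p) (pr x 0))) K))"

text \<open>A frame of tag 2 is \<open>pr 2 (pr h (pr k (pr x i)))\<close>: step program, number of
  rounds, parameter, rounds done. A frame of tag 3 is \<open>pr 3 (pr g (pr x i))\<close>: tested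
  program, parameter, current candidate.\<close>

definition step_ret :: "nat \<Rightarrow> nat \<Rightarrow> nat \<Rightarrow> nat" where
  "step_ret v fr K =
    (if p1 fr = 0 then eval_state (p1 (p2 fr)) (p2 (p2 fr)) (push (pr 4 v) K)
     else if p1 fr = 4 then ret_state (pr (p2 fr) v) K
     else if p1 fr = 1 then eval_state (p2 fr) v K
     else if p1 fr = 2 then
       (if p2 (p2 (p2 (p2 fr))) = p1 (p2 (p2 fr)) then ret_state v K
        else eval_state (p1 (p2 fr)) (pr (p2 (p2 (p2 (p2 fr)))) (pr v (p1 (p2 (p2 (p2 fr))))))
          (push (pr 2 (pr (p1 (p2 fr)) (pr (p1 (p2 (p2 fr)))
            (pr (p1 (p2 (p2 (p2 fr)))) (Suc (p2 (p2 (p2 (p2 fr))))))))) K))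
     else
       (if v = 0 then ret_state (p2 (p2 (p2 fr))) K
        else eval_state (p1 (p2 fr)) (pr (Suc (p2 (p2 (p2 fr)))) (p1 (p2 (p2 fr))))
          (push (pr 3 (pr (p1 (p2 fr)) (pr (p1 (p2 (p2 fr))) (Suc (p2 (p2 (p2 fr))))))) K)))"

definition step :: "nat \<Rightarrow> nat" where
  "step s =
    (if p1 s = 0 then step_eval (p1 (p2 s)) (p1 (p2 (p2 s))) (p2 (p2 (p2 s)))
     else if p2 (p2 s) = 0 then s
     else step_ret (p1 (p2 s)) (p1 (p2 (p2 s) - 1)) (p2 (p2 (p2 s) - 1)))"

lemma computable1_step: "computable1 step"
proof -
  have e: "computable1 (\<lambda>p. step_eval (p1 p) (p1 (p2 p)) (p2 (p2 p)))"
    unfolding step_eval_def eval_state_def ret_state_def push_def by (intro comp_intros)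
  have r: "computable1 (\<lambda>p. step_ret (p1 p) (p1 (p2 p)) (p2 (p2 p)))"
    unfolding step_ret_def eval_state_def ret_state_def push_def by (intro comp_intros)
  show ?thesis
    unfolding step_def[abs_def]
    by (intro comp_intros computable_curry3[OF e] computable_curry3[OF r])
qed

lemma step_eval_state: "step (eval_state p x K) = step_eval p x K"
  by (simp add: step_def eval_state_def)

lemma step_ret_state: "step (ret_state v (push fr K)) = step_ret v fr K"
  by (simp add: step_def ret_state_def push_def)

text \<open>Halted states are fixed points, so two halting runs from one state can be prolonged to
  the same length and compared.\<close>

lemma step_final: "(step ^^ n) (ret_state v 0) = ret_state v 0"
  by (induction n) (simp_all add: step_def ret_state_def)

lemma ret_state_inject: "ret_state v K = ret_state w L \<Longrightarrow> v = w"
  unfolding ret_state_def by (metis p1_pr p2_pr)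

section \<open>Correctness of the machine for each program constructor\<close>

definition reach :: "nat \<Rightarrow> nat \<Rightarrow> bool" where
  "reach s t \<longleftrightarrow> (\<exists>n. (step ^^ n) s = t)"

lemma reach_trans [trans]: "reach s t \<Longrightarrow> reach t u \<Longrightarrow> reach s u"
  unfolding reach_def by (metis funpow_add comp_apply)

lemma reach_step: "reach s (step s)"
  unfolding reach_def by (intro exI[of _ 1]) simp

lemma reach_eval: "reach (eval_state p x K) (step_eval p x K)"
  using reach_step[of "eval_state p x K"] by (simp add: step_eval_state)

lemma reach_ret: "reach (ret_state v (push fr K)) (step_ret v fr K)"
  using reach_step[of "ret_state v (push fr K)"] by (simp add: step_ret_state)

text \<open>Quantifying over the stack makes a subprogram usable below any pending frames.\<close>

definition runs :: "nat \<Rightarrow> nat \<Rightarrow> nat \<Rightarrow> bool" where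
  "runs p x v \<longleftrightarrow> (\<forall>K. reach (eval_state p x K) (ret_state v K))"

lemma runsD: "runs p x v \<Longrightarrow> reach (eval_state p x K) (ret_state v K)"
  by (simp add: runs_def)

lemma runs_zero: "runs (pr 0 0) x 0"
  and runs_succ: "runs (pr 1 0) x (Suc x)"
  and runs_fst: "runs (pr 2 0) x (p1 x)"
  and runs_snd: "runs (pr 3 0) x (p2 x)"
  unfolding runs_def
  using reach_eval[of "pr 0 0" x] reach_eval[of "pr 1 0" x]
    reach_eval[of "pr 2 0" x] reach_eval[of "pr 3 0" x]
  by (simp_all add: step_eval_def)

lemma runs_pair:
  assumes "runs p x u" "runs q x v"
  shows "runs (pr 4 (pr p q)) x (pr u v)"
  unfolding runs_def
proof
  fix K
  have "reach (eval_state (pr 4 (pr p q)) x K) (eval_state p x (push (pr 0 (pr q x)) K))"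
    using reach_eval[of "pr 4 (pr p q)" x K] by (simp add: step_eval_def)
  also have "reach \<dots> (ret_state u (push (pr 0 (pr q x)) K))"
    by (rule runsD[OF assms(1)])
  also have "reach \<dots> (eval_state q x (push (pr 4 u) K))"
    using reach_ret[of u "pr 0 (pr q x)" K] by (simp add: step_ret_def)
  also have "reach \<dots> (ret_state v (push (pr 4 u) K))"
    by (rule runsD[OF assms(2)])
  also have "reach \<dots> (ret_state (pr u v) K)"
    using reach_ret[of v "pr 4 u" K] by (simp add: step_ret_def)
  finally show "reach (eval_state (pr 4 (pr p q)) x K) (ret_state (pr u v) K)" .
qed

lemma runs_comp:
  assumes "runs q x u" "runs p u v"
  shows "runs (pr 5 (pr p q)) x v"
  unfolding runs_def
proof
  fix K
  have "reach (eval_state (pr 5 (pr p q)) x K) (eval_state q x (push (pr 1 p) K))"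
    using reach_eval[of "pr 5 (pr p q)" x K] by (simp add: step_eval_def)
  also have "reach \<dots> (ret_state u (push (pr 1 p) K))"
    by (rule runsD[OF assms(1)])
  also have "reach \<dots> (eval_state p u K)"
    using reach_ret[of u "pr 1 p" K] by (simp add: step_ret_def)
  also have "reach \<dots> (ret_state v K)"
    by (rule runsD[OF assms(2)])
  finally show "reach (eval_state (pr 5 (pr p q)) x K) (ret_state v K)" .
qed

text \<open>Induction on the finished rounds: after \<open>i\<close> of them the machine returns
  \<open>r i\<close> to a frame that records \<open>i\<close>; at \<open>i = k\<close> the frame is
  popped.\<close>

lemma runs_rec:
  assumes "runs g x (r 0)" "\<And>i. i < k \<Longrightarrow> runs h (pr i (pr (r i) x)) (r (Suc i))"
  shows "runs (pr 6 (pr g h)) (pr k x) (r k)"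
  unfolding runs_def
proof
  fix K
  let ?fr = "\<lambda>i. pr 2 (pr h (pr k (pr x i)))"
  have "reach (eval_state (pr 6 (pr g h)) (pr k x) K) (eval_state g x (push (?fr 0) K))"
    using reach_eval[of "pr 6 (pr g h)" "pr k x" K] by (simp add: step_eval_def)
  also have "reach \<dots> (ret_state (r 0) (push (?fr 0) K))"
    by (rule runsD[OF assms(1)])
  finally have start: "reach (eval_state (pr 6 (pr g h)) (pr k x) K) (ret_state (r 0) (push (?fr 0) K))" .
  have "reach (eval_state (pr 6 (pr g h)) (pr k x) K) (ret_state (r i) (push (?fr i) K))" if "i \<le> k" for i
    using that
  proof (induction i)
    case 0
    show ?case by (rule start)
  next
    case (Suc i)
    note Suc.IH[OF Suc_leD[OF Suc.prems]]
    also have "reach (ret_state (r i) (push (?fr i) K)) (eval_state h (pr i (pr (r i) x)) (push (?fr (Suc i)) K))"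
      using reach_ret[of "r i" "?fr i" K] Suc.prems by (simp add: step_ret_def)
    also have "reach \<dots> (ret_state (r (Suc i)) (push (?fr (Suc i)) K))"
      using Suc.prems by (intro runsD[OF assms(2)]) simp
    finally show ?case .
  qed
  from this[of k] have "reach (eval_state (pr 6 (pr g h)) (pr k x) K) (ret_state (r k) (push (?fr k) K))"
    by simp
  also have "reach \<dots> (ret_state (r k) K)"
    using reach_ret[of "r k" "?fr k" K] by (simp add: step_ret_def)
  finally show "reach (eval_state (pr 6 (pr g h)) (pr k x) K) (ret_state (r k) K)" .
qed

lemma runs_mu:
  assumes "\<And>i. i < m \<Longrightarrow> \<exists>v. v \<noteq> 0 \<and> runs g (pr i x) v" "runs g (pr m x) 0"
  shows "runs (pr 7 g) x m"
  unfolding runs_def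
proof
  fix K
  let ?fr = "\<lambda>i. pr 3 (pr g (pr x i))"
  have start: "reach (eval_state (pr 7 g) x K) (eval_state g (pr 0 x) (push (?fr 0) K))"
    using reach_eval[of "pr 7 g" x K] by (simp add: step_eval_def)
  have "reach (eval_state (pr 7 g) x K) (eval_state g (pr i x) (push (?fr i) K))" if "i \<le> m" for i
    using that
  proof (induction i)
    case 0
    show ?case by (rule start)
  next
    case (Suc i)
    obtain v where v: "v \<noteq> 0" "runs g (pr i x) v" using assms(1)[of i] Suc.prems by auto
    note Suc.IH[OF Suc_leD[OF Suc.prems]]
    also have "reach (eval_state g (pr i x) (push (?fr i) K)) (ret_state v (push (?fr i) K))"
      by (rule runsD[OF v(2)])
    also have "reach \<dots> (eval_state g (pr (Suc i) x) (push (?fr (Suc i)) K))"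
      using reach_ret[of v "?fr i" K] v(1) by (simp add: step_ret_def)
    finally show ?case .
  qed
  from this[of m] have "reach (eval_state (pr 7 g) x K) (eval_state g (pr m x) (push (?fr m) K))" by simp
  also have "reach \<dots> (ret_state 0 (push (?fr m) K))"
    by (rule runsD[OF assms(2)])
  also have "reach \<dots> (ret_state m K)"
    using reach_ret[of 0 "?fr m" K] by (simp add: step_ret_def)
  finally show "reach (eval_state (pr 7 g) x K) (ret_state m K)" .
qed

section \<open>Compiling recursive functions into programs\<close>

fun list_code :: "nat list \<Rightarrow> nat" where
  "list_code [] = 0"
| "list_code (x # xs) = pr x (list_code xs)"

text \<open>Programs take a single input, so the argument list of a composition is assembled by
  nested pairing, with the zero program for the empty list.\<close>

lemma ex_program_map:
  assumes "\<And>i. i < m \<Longrightarrow> \<exists>p. \<forall>xs. length xs = n \<longrightarrow> runs p (list_code xs) (h i xs)"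
  shows "\<exists>p. \<forall>xs. length xs = n \<longrightarrow>
    runs p (list_code xs) (list_code (map (\<lambda>i. h i xs) [0..<m]))"
  using assms
proof (induction m arbitrary: h)
  case 0
  then show ?case using runs_zero by auto
next
  case (Suc m)
  obtain p where p: "\<And>xs. length xs = n \<Longrightarrow> runs p (list_code xs) (h 0 xs)"
    using Suc.prems[of 0] by auto
  obtain q where q: "\<And>xs. length xs = n \<Longrightarrow>
      runs q (list_code xs) (list_code (map (\<lambda>i. h (Suc i) xs) [0..<m]))"
    using Suc.IH[of "\<lambda>i. h (Suc i)"] Suc.prems by auto
  have "map (\<lambda>i. h i xs) [0..<Suc m] = h 0 xs # map (\<lambda>i. h (Suc i) xs) [0..<m]" for xs
    by (rule map_upt_Suc)
  then show ?case using runs_pair[OF p q] by (metis list_code.simps(2))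
qed

lemma ex_program_nth: "\<exists>p. \<forall>xs. i < length xs \<longrightarrow> runs p (list_code xs) (xs ! i)"
proof (induction i)
  case 0
  have "runs (pr 2 0) (list_code xs) (xs ! 0)" if "0 < length xs" for xs
    using that runs_fst[of "list_code xs"] by (cases xs) auto
  then show ?case by blast
next
  case (Suc i)
  then obtain p where p: "\<And>xs. i < length xs \<Longrightarrow> runs p (list_code xs) (xs ! i)" by auto
  have "runs (pr 5 (pr p (pr 3 0))) (list_code xs) (xs ! Suc i)" if len: "Suc i < length xs" for xs
  proof (cases xs)
    case (Cons y ys)
    show ?thesis
      using len Cons by (intro runs_comp[OF runs_snd]) (auto intro: p)
  qed (use len in simp)
  then show ?case by blast
qed

text \<open>Each scheme is compiled separately. Since \<open>list_code (k # xs)\<close> is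
  \<open>pr k (list_code xs)\<close>, the arguments of primitive recursion and of the minimized
  function already have the form that tags 6 and 7 use.\<close>

lemma total_recursive_ex_program:
  assumes "total_recursive n F"
  shows "\<exists>p. \<forall>xs. length xs = n \<longrightarrow> runs p (list_code xs) (F xs)"
  using assms
proof induction
  case (zero n)
  then show ?case using runs_zero by blast
next
  case succ
  obtain p where p: "\<And>xs. 0 < length xs \<Longrightarrow> runs p (list_code xs) (xs ! 0)"
    using ex_program_nth[of 0] by auto
  have "runs (pr 5 (pr (pr 1 0) p)) (list_code xs) (Suc (xs ! 0))" if "length xs = 1" for xs
    using that by (intro runs_comp[OF p] runs_succ) simp
  then show ?case by blast
next
  case (proj i n)
  then show ?case using ex_program_nth[of i] by metis
next
  case (comp m g n h)
  obtain p where p: "\<And>ys. length ys = m \<Longrightarrow> runs p (list_code ys) (g ys)"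
    using comp.IH(1) by auto
  obtain q where q: "\<And>xs. length xs = n \<Longrightarrow>
      runs q (list_code xs) (list_code (map (\<lambda>i. h i xs) [0..<m]))"
    using ex_program_map[of m n h] comp.IH(2) by auto
  have "runs (pr 5 (pr p q)) (list_code xs) (g (map (\<lambda>i. h i xs) [0..<m]))"
    if "length xs = n" for xs
    using that by (intro runs_comp[OF q] p) auto
  then show ?case by blast
next
  case (prim_rec n g h)
  obtain p where p: "\<And>ys. length ys = n \<Longrightarrow> runs p (list_code ys) (g ys)"
    using prim_rec.IH(1) by auto
  obtain q where q: "\<And>ys. length ys = Suc (Suc n) \<Longrightarrow> runs q (list_code ys) (h ys)"
    using prim_rec.IH(2) by auto
  have "runs (pr 6 (pr p q)) (list_code xs)
      (rec_nat (g (tl xs)) (\<lambda>k r. h (k # r # tl xs)) (hd xs))" if "length xs = Suc n" for xs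
  proof -
    obtain y ys where xs: "xs = y # ys" "length ys = n" using \<open>length xs = Suc n\<close> by (cases xs) auto
    have "runs (pr 6 (pr p q)) (pr y (list_code ys)) (rec_nat (g ys) (\<lambda>k r. h (k # r # ys)) y)"
    proof (rule runs_rec)
      show "runs p (list_code ys) (rec_nat (g ys) (\<lambda>k r. h (k # r # ys)) 0)"
        using p xs(2) by simp
    next
      fix i
      let ?r = "rec_nat (g ys) (\<lambda>k r. h (k # r # ys))"
      show "runs q (pr i (pr (?r i) (list_code ys))) (?r (Suc i))"
        using q[of "i # ?r i # ys"] xs(2) by simp
    qed
    then show ?thesis using xs by simp
  qed
  then show ?case by blast
next
  case (minimize n g)
  obtain p where p: "\<And>ys. length ys = Suc n \<Longrightarrow> runs p (list_code ys) (g ys)"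
    using minimize.IH(1) by auto
  have "runs (pr 7 p) (list_code xs) (LEAST y. g (y # xs) = 0)" if len: "length xs = n" for xs
  proof (rule runs_mu)
    fix i assume "i < (LEAST y. g (y # xs) = 0)"
    then have "g (i # xs) \<noteq> 0" by (rule not_less_Least)
    moreover have "runs p (pr i (list_code xs)) (g (i # xs))" using p[of "i # xs"] len by simp
    ultimately show "\<exists>v. v \<noteq> 0 \<and> runs p (pr i (list_code xs)) v" by blast
  next
    have "g ((LEAST y. g (y # xs) = 0) # xs) = 0"
      using minimize.hyps(2)[OF len] by (rule LeastI_ex)
    then show "runs p (pr (LEAST y. g (y # xs) = 0) (list_code xs)) 0"
      using p[of "(LEAST y. g (y # xs) = 0) # xs"] len by simp
  qed
  then show ?case by blast
qed

text \<open>The number \<open>t\<close> codes a third argument together with a number of computation steps.\<close>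

definition refutes :: "nat \<Rightarrow> nat \<Rightarrow> nat \<Rightarrow> nat \<Rightarrow> bool" where
  "refutes e x a t \<longleftrightarrow>
    (step ^^ p2 t) (eval_state e (list_code [x, a, p1 t]) 0) = ret_state 0 0"

lemma decidable_refutes:
  assumes "computable1 e" "computable1 f" "computable1 g" "computable1 h"
  shows "decidable (\<lambda>x. refutes (e x) (f x) (g x) (h x))"
  unfolding refutes_def eval_state_def ret_state_def list_code.simps
  by (intro comp_intros assms computable1_step)

text \<open>This enumerates the \<open>\<Sigma>\<^sup>0\<^sub>2\<close> sets: \<open>x\<close>
  belongs to the set with index \<open>e\<close> iff some \<open>a\<close> is never refuted.
  Counting steps makes \<open>refutes\<close> decidable for every \<open>e\<close>, even for
  programs that do not halt.\<close>

lemma computable_rel3_ex_refutes: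
  assumes "computable_rel3 R"
  shows "\<exists>e. \<forall>x a. (\<exists>t. refutes e x a t) \<longleftrightarrow> (\<exists>b. \<not> R x a b)"
proof -
  obtain F where F: "total_recursive 3 F" "\<And>x y z. F [x, y, z] = (if R x y z then 1 else 0)"
    using assms by (auto simp: computable_rel3_def)
  obtain e where "\<And>xs. length xs = 3 \<Longrightarrow> runs e (list_code xs) (F xs)"
    using total_recursive_ex_program[OF F(1)] by auto
  then have e: "runs e (list_code [x, a, b]) (if R x a b then 1 else 0)" for x a b
    using F(2)[of x a b] by (metis length_Cons list.size(3) numeral_3_eq_3)
  have "(\<exists>t. refutes e x a t) \<longleftrightarrow> (\<exists>b. \<not> R x a b)" for x a
  proof
    assume "\<exists>t. refutes e x a t"
    then obtain t where t: "refutes e x a t" ..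
    define b where "b = p1 t"
    obtain n where n: "(step ^^ n) (eval_state e (list_code [x, a, b]) 0) =
        ret_state (if R x a b then 1 else 0) 0"
      using runsD[OF e] unfolding reach_def by blast
    have m: "(step ^^ p2 t) (eval_state e (list_code [x, a, b]) 0) = ret_state 0 0"
      using t unfolding refutes_def b_def .
    \<comment> \<open>Both halting runs are extended to \<open>n + p2 t\<close> steps; their results
      must coincide.\<close>
    have "(step ^^ (n + p2 t)) (eval_state e (list_code [x, a, b]) 0) = ret_state 0 0"
      unfolding funpow_add comp_apply m by (rule step_final)
    moreover have "(step ^^ (n + p2 t)) (eval_state e (list_code [x, a, b]) 0) =
        ret_state (if R x a b then 1 else 0) 0"
      unfolding add.commute[of n] funpow_add comp_apply n by (rule step_final)
    ultimately have "(if R x a b then 1 else 0) = (0::nat)" by (metis ret_state_inject)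
    then show "\<exists>b. \<not> R x a b" by (metis one_neq_zero)
  next
    assume "\<exists>b. \<not> R x a b"
    then obtain b where "\<not> R x a b" ..
    then have "runs e (list_code [x, a, b]) 0" using e[of x a b] by simp
    then obtain n where "(step ^^ n) (eval_state e (list_code [x, a, b]) 0) = ret_state 0 0"
      using runsD unfolding reach_def by blast
    then have "refutes e x a (pr b n)" by (simp add: refutes_def)
    then show "\<exists>t. refutes e x a t" ..
  qed
  then show ?thesis by blast
qed

section \<open>Two-colourings of finite hypergraphs\<close>

definition mono_on_colour :: "(nat \<Rightarrow> bool) \<Rightarrow> nat set \<Rightarrow> bool" where
  "mono_on_colour c A \<longleftrightarrow> (\<exists>k. \<forall>j\<in>A. c j = k)"

text \<open>Extensional functions make the colourings countable as a finite set. Only sets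
  \<open>A i\<close> inside \<open>S\<close> constrain them, so vertices can be added one at a
  time.\<close>

definition good_cols :: "'i set \<Rightarrow> ('i \<Rightarrow> nat set) \<Rightarrow> nat set \<Rightarrow> (nat \<Rightarrow> bool) set" where
  "good_cols I A S = {c \<in> S \<rightarrow>\<^sub>E UNIV. \<forall>i\<in>I. A i \<subseteq> S \<longrightarrow> \<not> mono_on_colour c (A i)}"

lemma finite_good_cols: "finite S \<Longrightarrow> finite (good_cols I A S)"
  unfolding good_cols_def by (rule finite_subset[of _ "S \<rightarrow>\<^sub>E UNIV"]) (auto intro: finite_PiE)

lemma good_cols_restrict:
  assumes "c \<in> good_cols I A S" "T \<subseteq> S"
  shows "restrict c T \<in> good_cols I A T"
proof -
  have "\<not> mono_on_colour (restrict c T) (A i)" if i: "i \<in> I" "A i \<subseteq> T" for i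
  proof -
    have "\<not> mono_on_colour c (A i)" using assms i by (auto simp: good_cols_def)
    moreover have "restrict c T j = c j" if "j \<in> A i" for j using that i by auto
    ultimately show ?thesis by (simp add: mono_on_colour_def)
  qed
  then show ?thesis by (auto simp: good_cols_def)
qed

text \<open>
  Rosenfeld's counting replaces the local lemma: of the \<open>2 * card (good_cols I A S)\<close> extensions to
  \<open>v\<close>, those that make \<open>A i\<close> monochromatic are determined by one colour and their restriction to
  \<open>S - A i\<close>, and by induction that restriction ranges over a set smaller by a factor
  \<open>(2/3) ^ (card (A i) - 1)\<close>.
\<close>

lemma card_good_cols_step:
  fixes A :: "'i \<Rightarrow> nat set"
  assumes I: "finite I" and S: "finite S" "v \<notin> S"
    and w: "(\<Sum>i | i \<in> I \<and> v \<in> A i. (2/3::real) ^ (card (A i) - 1)) \<le> 1/4"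
    and IH: "\<And>T. T \<subseteq> S \<Longrightarrow>
      real (card (good_cols I A T)) \<le> (2/3) ^ card (S - T) * real (card (good_cols I A S))"
  shows "3/2 * real (card (good_cols I A S)) \<le> real (card (good_cols I A (insert v S)))"
proof -
  let ?G = "good_cols I A"
  define I' where "I' = {i \<in> I. v \<in> A i \<and> A i \<subseteq> insert v S}"
  define bad where "bad i = {c \<in> insert v S \<rightarrow>\<^sub>E (UNIV :: bool set).
      restrict c S \<in> ?G S \<and> mono_on_colour c (A i)}" for i
  define ext where "ext = (\<lambda>(c, k). c(v := k)) ` (?G S \<times> (UNIV :: bool set))"
  have finG: "finite (?G S)" by (rule finite_good_cols[OF S(1)])
  have finI': "finite I'" using I by (simp add: I'_def)
  have finbad: "finite (bad i)" for i
    unfolding bad_def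
    by (rule finite_subset[of _ "insert v S \<rightarrow>\<^sub>E UNIV"]) (auto intro: finite_PiE S)
  have "inj_on (\<lambda>(c, k). c(v := k)) (?G S \<times> (UNIV :: bool set))"
  proof (rule inj_onI, clarsimp)
    fix c k d l
    assume c: "c \<in> ?G S" and d: "d \<in> ?G S" and eq: "c(v := k) = d(v := l)"
    have kl: "k = l" using fun_cong[OF eq, of v] by simp
    have "c j = d j" for j
    proof (cases "j = v")
      case True
      then show ?thesis using c d S(2) by (auto simp: good_cols_def PiE_def extensional_def)
    next
      case False
      then show ?thesis using fun_cong[OF eq, of j] by simp
    qed
    with kl show "c = d \<and> k = l" by auto
  qed
  then have card_ext: "card ext = 2 * card (?G S)"
    by (simp add: ext_def card_image card_cartesian_product)
  have ext_sub: "ext \<subseteq> ?G (insert v S) \<union> (\<Union>i\<in>I'. bad i)"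
  proof
    fix c assume "c \<in> ext"
    then obtain d k where d: "d \<in> ?G S" and c: "c = d(v := k)" by (auto simp: ext_def)
    have cE: "c \<in> insert v S \<rightarrow>\<^sub>E UNIV"
      using d by (auto simp: c good_cols_def PiE_def extensional_def)
    have "restrict c S = d"
      using d S(2) by (auto simp: c good_cols_def PiE_def extensional_def fun_eq_iff)
    with d have r: "restrict c S \<in> ?G S" by simp
    show "c \<in> ?G (insert v S) \<union> (\<Union>i\<in>I'. bad i)"
    proof (cases "\<forall>i\<in>I. A i \<subseteq> insert v S \<longrightarrow> \<not> mono_on_colour c (A i)")
      case True
      then show ?thesis using cE by (simp add: good_cols_def)
    next
      case False
      then obtain i where i: "i \<in> I" "A i \<subseteq> insert v S" "mono_on_colour c (A i)" by auto
      have "v \<in> A i"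
      proof (rule ccontr)
        assume v: "v \<notin> A i"
        then have sub: "A i \<subseteq> S" using i(2) by auto
        then have "mono_on_colour (restrict c S) (A i)"
          using i(3) unfolding mono_on_colour_def by (metis restrict_apply' subsetD)
        then show False using r i(1) sub by (auto simp: good_cols_def)
      qed
      then have "i \<in> I'" "c \<in> bad i" using i cE r by (auto simp: I'_def bad_def)
      then show ?thesis by blast
    qed
  qed
  have card_bad: "real (card (bad i)) \<le> 2 * (2/3) ^ (card (A i) - 1) * real (card (?G S))"
    if i: "i \<in> I'" for i
  proof -
    let ?T = "S - A i"
    have "inj_on (\<lambda>c. (restrict c ?T, c v)) (bad i)"
    proof (rule inj_onI)
      fix c d assume c: "c \<in> bad i" and d: "d \<in> bad i"
        and eq: "(restrict c ?T, c v) = (restrict d ?T, d v)"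
      have cv: "c j = c v" "d j = d v" if "j \<in> A i" for j
        using c d i that by (auto simp: bad_def mono_on_colour_def I'_def)
      have "c j = d j" for j
      proof -
        consider "j \<in> A i" | "j \<in> ?T" | "j \<notin> insert v S" using i by (auto simp: I'_def)
        then show ?thesis
        proof cases
          case 1
          then show ?thesis using cv eq by simp
        next
          case 2
          then show ?thesis using eq by (metis prod.inject restrict_apply')
        next
          case 3
          then show ?thesis using c d by (auto simp: bad_def PiE_def extensional_def)
        qed
      qed
      then show "c = d" by auto
    qed
    moreover have "(\<lambda>c. (restrict c ?T, c v)) ` bad i \<subseteq> ?G ?T \<times> UNIV"
    proof -
      have "restrict c ?T \<in> ?G ?T" if "c \<in> bad i" for c
      proof -
        have "restrict (restrict c S) ?T \<in> ?G ?T"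
        proof (rule good_cols_restrict)
          show "restrict c S \<in> ?G S" using that by (simp add: bad_def)
        qed auto
        moreover have "restrict (restrict c S) ?T = restrict c ?T" by (simp add: Int_absorb1)
        ultimately show ?thesis by simp
      qed
      then show ?thesis by auto
    qed
    moreover have "finite (?G ?T \<times> (UNIV :: bool set))"
      using finite_good_cols[of ?T I A] S(1) by simp
    ultimately have "card (bad i) \<le> card (?G ?T \<times> (UNIV :: bool set))"
      by (rule card_inj_on_le)
    then have "real (card (bad i)) \<le> 2 * real (card (?G ?T))"
      by (simp add: card_cartesian_product)
    also have "\<dots> \<le> 2 * ((2/3) ^ card (S - ?T) * real (card (?G S)))"
      using IH[of ?T] by simp
    also have "S - ?T = A i - {v}" using i S(2) by (auto simp: I'_def)
    also have "card (A i - {v}) = card (A i) - 1"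
      using i finite_subset[of "A i" "insert v S"] S(1) by (simp add: I'_def)
    finally show ?thesis by simp
  qed
  have "2 * card (?G S) \<le> card (?G (insert v S) \<union> (\<Union>i\<in>I'. bad i))"
    unfolding card_ext[symmetric] using finI' finbad S
    by (intro card_mono ext_sub) (auto intro: finite_good_cols)
  also have "\<dots> \<le> card (?G (insert v S)) + card (\<Union>i\<in>I'. bad i)" by (rule card_Un_le)
  also have "card (\<Union>i\<in>I'. bad i) \<le> (\<Sum>i\<in>I'. card (bad i))" by (rule card_UN_le[OF finI'])
  finally have "real (2 * card (?G S)) \<le> real (card (?G (insert v S)) + (\<Sum>i\<in>I'. card (bad i)))"
    by (intro of_nat_mono) simp
  then have "2 * real (card (?G S)) \<le> real (card (?G (insert v S))) + (\<Sum>i\<in>I'. real (card (bad i)))"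
    by simp
  also have "(\<Sum>i\<in>I'. real (card (bad i))) \<le>
      (\<Sum>i\<in>I'. 2 * (2/3) ^ (card (A i) - 1) * real (card (?G S)))"
    by (rule sum_mono) (rule card_bad)
  also have "\<dots> = 2 * real (card (?G S)) * (\<Sum>i\<in>I'. (2/3) ^ (card (A i) - 1))"
    by (simp add: sum_distrib_left mult_ac)
  also have "\<dots> \<le> 2 * real (card (?G S)) * (1/4)"
  proof (rule mult_left_mono)
    have "(\<Sum>i\<in>I'. (2/3::real) ^ (card (A i) - 1)) \<le>
        (\<Sum>i | i \<in> I \<and> v \<in> A i. (2/3::real) ^ (card (A i) - 1))"
      by (rule sum_mono2) (use I in \<open>auto simp: I'_def\<close>)
    with w show "(\<Sum>i\<in>I'. (2/3::real) ^ (card (A i) - 1)) \<le> 1/4" by simp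
  qed simp
  \<comment> \<open>The bad extensions number at most half of \<open>card (?G S)\<close>, and
    \<open>2 - 1/2 = 3/2\<close>.\<close>
  finally show ?thesis by simp
qed

text \<open>Iterates the one-vertex step. The induction is on \<open>card S\<close> because that
  step consumes this same inequality for all subsets of the smaller set.\<close>

lemma card_good_cols_subset:
  fixes A :: "'i \<Rightarrow> nat set"
  assumes I: "finite I" and "finite S"
    and w: "\<And>v. v \<in> S \<Longrightarrow> (\<Sum>i | i \<in> I \<and> v \<in> A i. (2/3::real) ^ (card (A i) - 1)) \<le> 1/4"
    and "T \<subseteq> S"
  shows "real (card (good_cols I A T)) \<le> (2/3) ^ card (S - T) * real (card (good_cols I A S))"
  using assms(2-)
proof (induction "card S" arbitrary: S T rule: less_induct)
  case less
  show ?case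
  proof (cases "T = S")
    case False
    then obtain v where v: "v \<in> S" "v \<notin> T" using less.prems by auto
    let ?S = "S - {v}"
    have lt: "card ?S < card S" using v less.prems(1) by (intro card_Diff1_less) auto
    have IH: "real (card (good_cols I A U)) \<le> (2/3) ^ card (?S - U) * real (card (good_cols I A ?S))"
      if "U \<subseteq> ?S" for U
      using less.hyps[OF lt, of U] less.prems that by auto
    have "3/2 * real (card (good_cols I A ?S)) \<le> real (card (good_cols I A (insert v ?S)))"
      by (rule card_good_cols_step[OF I]) (use less.prems v IH in auto)
    then have step: "3/2 * real (card (good_cols I A ?S)) \<le> real (card (good_cols I A S))"
      using v by (simp add: insert_absorb)
    have "S - T = insert v (?S - T)" using v by auto
    then have Suc: "card (S - T) = Suc (card (?S - T))"
      using less.prems(1) by (metis card_insert_disjoint Diff_iff finite_Diff insertI1)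
    have "real (card (good_cols I A T)) \<le> (2/3) ^ card (?S - T) * real (card (good_cols I A ?S))"
      using IH[of T] v less.prems by auto
    also have "\<dots> \<le> (2/3) ^ card (?S - T) * (2/3 * real (card (good_cols I A S)))"
      using step by (intro mult_left_mono) auto
    also have "\<dots> = (2/3) ^ card (S - T) * real (card (good_cols I A S))"
      by (simp add: Suc)
    finally show ?thesis .
  qed simp
qed

lemma ex_no_monochromatic:
  fixes A :: "'i \<Rightarrow> nat set"
  assumes I: "finite I" and S: "finite S" "\<And>i. i \<in> I \<Longrightarrow> A i \<subseteq> S" "\<And>i. i \<in> I \<Longrightarrow> A i \<noteq> {}"
    and w: "\<And>v. v \<in> S \<Longrightarrow> (\<Sum>i | i \<in> I \<and> v \<in> A i. (2/3::real) ^ (card (A i) - 1)) \<le> 1/4"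
  shows "\<exists>c :: nat \<Rightarrow> bool. \<forall>i\<in>I. (\<exists>j\<in>A i. c j) \<and> (\<exists>j\<in>A i. \<not> c j)"
proof -
  \<comment> \<open>No \<open>A i\<close> is empty, so the colouring of the empty set is good; the
    counting inequality carries this positive count over to \<open>S\<close>.\<close>
  have "(\<lambda>_. undefined) \<in> good_cols I A {}" using S(3) by (auto simp: good_cols_def)
  then have "0 < card (good_cols I A {})"
    using finite_good_cols[of "{}" I A] by (auto simp: card_gt_0_iff)
  then have "0 < (2/3) ^ card (S - {}) * real (card (good_cols I A S))"
    using card_good_cols_subset[OF I S(1) w, of "{}"] by simp
  then have "good_cols I A S \<noteq> {}" by (auto simp: zero_less_mult_iff)
  then obtain c where "c \<in> good_cols I A S" by auto
  then have "\<forall>i\<in>I. \<not> mono_on_colour c (A i)" using S(2) by (auto simp: good_cols_def)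
  then show ?thesis unfolding mono_on_colour_def by (metis (full_types))
qed

section \<open>The diagonal colouring\<close>

text \<open>The left side will bound the total weight of the clauses of index \<open>e\<close>
  through one number; the right sides sum to at most 1/4. Large \<open>K\<close> settles
  \<open>e = 0\<close>, and each increment of \<open>e\<close> costs a factor of at most
  \<open>2 * (2/3)^4 = 32/81 < 1/2\<close>.\<close>

lemma ex_weight_constant:
  fixes b :: nat
  shows "\<exists>K\<ge>4. \<forall>e. real (2 * b * (K + 4 * e) * b) * (2/3) ^ (K + 4 * e - 1) \<le> (1/8) * (1/2) ^ e"
proof -
  \<comment> \<open>The factor 3 is \<open>2 * (3/2)\<close>, where 3/2 compensates for the exponent
    \<open>K + 4 * e - 1\<close>.\<close>
  define C where "C = 3 * (real b)\<^sup>2"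
  have "(\<lambda>n. C * (real n * (2/3) ^ n)) \<longlonglongrightarrow> C * 0"
    by (intro tendsto_intros powser_times_n_limit_0) auto
  then have "eventually (\<lambda>n. C * (real n * (2/3) ^ n) < 1/8) sequentially"
    by (rule order_tendstoD) auto
  moreover have "eventually (\<lambda>n. 4 \<le> n) sequentially" by (rule eventually_ge_at_top)
  ultimately have "eventually (\<lambda>n. C * (real n * (2/3) ^ n) < 1/8 \<and> 4 \<le> n) sequentially"
    by (rule eventually_conj)
  then obtain K where K: "C * (real K * (2/3) ^ K) < 1/8" "4 \<le> K"
    by (auto simp: eventually_sequentially)
  have le: "C * (real (K + 4 * e) * (2/3) ^ (K + 4 * e)) \<le> (1/8) * (1/2) ^ e" for e
  proof (induction e)
    case (Suc e)
    have "real (K + 4 * Suc e) \<le> 2 * real (K + 4 * e)" using K(2) by simp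
    then have "C * (real (K + 4 * Suc e) * (2/3) ^ (K + 4 * Suc e)) \<le>
        C * (2 * real (K + 4 * e) * (2/3) ^ (K + 4 * Suc e))"
      by (intro mult_left_mono mult_right_mono) (auto simp: C_def)
    also have "\<dots> = 32/81 * (C * (real (K + 4 * e) * (2/3) ^ (K + 4 * e)))"
    proof -
      have "(2/3::real) ^ (K + 4 * Suc e) = 16/81 * (2/3) ^ (K + 4 * e)"
        by (simp add: power_add eval_nat_numeral)
      then show ?thesis by simp
    qed
    also have "\<dots> \<le> 1/2 * (C * (real (K + 4 * e) * (2/3) ^ (K + 4 * e)))"
      by (intro mult_right_mono) (auto simp: C_def)
    also have "\<dots> \<le> 1/2 * ((1/8) * (1/2) ^ e)"
      using Suc.IH by (intro mult_left_mono) auto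
    finally show ?case by simp
  qed (use K in simp)
  have "real (2 * b * (K + 4 * e) * b) * (2/3) ^ (K + 4 * e - 1) =
      C * (real (K + 4 * e) * (2/3) ^ (K + 4 * e))" for e
  proof -
    obtain m where "K + 4 * e = Suc m" using K(2) by (cases "K + 4 * e") auto
    then show ?thesis by (simp add: C_def power2_eq_square algebra_simps)
  qed
  then have "real (2 * b * (K + 4 * e) * b) * (2/3) ^ (K + 4 * e - 1) \<le> (1/8) * (1/2) ^ e" for e
    by (simp only: le)
  with K(2) show ?thesis by blast
qed

lemma card_fibres_le:
  assumes "finite S" "\<And>v. v \<in> T \<Longrightarrow> card {i \<in> S. h i = v} \<le> b" "finite T"
  shows "card {i \<in> S. h i \<in> T} \<le> b * card T"
proof -
  have "{i \<in> S. h i \<in> T} = (\<Union>v\<in>T. {i \<in> S. h i = v})" by auto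
  then have "card {i \<in> S. h i \<in> T} \<le> (\<Sum>v\<in>T. card {i \<in> S. h i = v})"
    using card_UN_le[OF assms(3), of "\<lambda>v. {i \<in> S. h i = v}"] by simp
  also have "\<dots> \<le> (\<Sum>v\<in>T. b)" by (rule sum_mono) (rule assms(2))
  finally show ?thesis by (simp add: mult.commute)
qed

section \<open>The construction: guesses, clauses, layers and the colouring\<close>

locale addition_like_function =
  fixes f :: "nat set \<Rightarrow> nat" and F g :: "nat \<Rightarrow> nat \<Rightarrow> nat" and b K :: nat
  assumes F: "computable2 F" and F_eq: "\<And>x y. x \<noteq> y \<Longrightarrow> F x y = f {x, y}"
    and g: "computable2 g" and g_bound: "\<And>x y n. g x n < y \<Longrightarrow> y \<noteq> x \<Longrightarrow> n < f {x, y}"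
    and fibre: "\<And>x y. x \<noteq> y \<Longrightarrow> finite {z. z \<noteq> x \<and> f {x, z} = f {x, y}} \<and>
      card {z. z \<noteq> x \<and> f {x, z} = f {x, y}} \<le> b"
    and b_pos: "0 < b" and K_ge: "4 \<le> K"
    and weight: "\<And>e. real (2 * b * (K + 4 * e) * b) * (2/3) ^ (K + 4 * e - 1) \<le> (1/8) * (1/2) ^ e"
begin

text \<open>The size of the candidate sets: the factor 2 pays for keeping half of a clause, the
  factor \<open>b\<close> for repeated values, leaving \<open>K + 4 * e\<close> distinct
  numbers.\<close>

definition N :: "nat \<Rightarrow> nat" where "N e = 2 * b * (K + 4 * e)"

lemma N_pos: "0 < N e"
  using b_pos K_ge by (simp add: N_def)

text \<open>
  A number \<open>w\<close> codes a sequence of pairs \<open>(x, a)\<close>, where \<open>a\<close> is meant to witness that \<open>x\<close> belongs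
  to the \<open>e\<close>-th \<open>\<Sigma>\<^sup>0\<^sub>2\<close> set. The alternative \<open>s \<le> w\<close> only makes the search for \<open>guess e s\<close> total.
\<close>

definition elt :: "nat \<Rightarrow> nat \<Rightarrow> nat" where "elt w i = p1 (seq_nth w i)"
definition wit :: "nat \<Rightarrow> nat \<Rightarrow> nat" where "wit w i = p2 (seq_nth w i)"

definition valid :: "nat \<Rightarrow> nat \<Rightarrow> bool" where
  "valid e w \<longleftrightarrow> (\<forall>i<N e. \<forall>j<i. elt w i \<noteq> elt w j)"

definition survives :: "nat \<Rightarrow> nat \<Rightarrow> nat \<Rightarrow> bool" where
  "survives e w s \<longleftrightarrow> (\<forall>i<N e. \<forall>t<s. \<not> refutes e (elt w i) (wit w i) t)"

definition guess :: "nat \<Rightarrow> nat \<Rightarrow> nat" where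
  "guess e s = (LEAST w. s \<le> w \<or> (valid e w \<and> survives e w s))"

text \<open>Guesses only grow with the stage, so this is when the guess in force at \<open>y\<close>
  first appeared; all earlier guesses were smaller.\<close>

definition start :: "nat \<Rightarrow> nat \<Rightarrow> nat" where
  "start e y = (LEAST s. guess e s = guess e y)"

text \<open>
  A new guess becomes active only once all its clause elements exceed every element used by
  earlier guesses. Hence a number lies in clauses of only one guess for each \<open>e\<close>, and
  boundedly many of them.
\<close>

definition used :: "nat \<Rightarrow> nat \<Rightarrow> nat" where
  "used e s = s + e + (\<Sum>t<s. \<Sum>i<N e. F (elt (guess e t) i) t)"

definition active :: "nat \<Rightarrow> nat \<Rightarrow> bool" where
  "active e y \<longleftrightarrow> valid e (guess e y) \<and>
    (\<forall>i<N e. elt (guess e y) i \<noteq> y \<and> g (elt (guess e y) i) (used e (start e y)) < y)"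

definition clause :: "nat \<Rightarrow> nat \<Rightarrow> nat \<Rightarrow> nat" where
  "clause e y i = F (elt (guess e y) i) y"

text \<open>An active clause with a value below \<open>a\<close> has index and \<open>start\<close>
  below \<open>a\<close>, so finitely many guesses matter; the sum stands in for a maximum of
  thresholds.\<close>

definition stage_bound :: "nat \<Rightarrow> nat" where
  "stage_bound a = (\<Sum>e<a. \<Sum>s<a. \<Sum>i<N e. \<Sum>j<a. g (elt (guess e s) i) j)"

text \<open>The sum dominates every active clause that has a value below \<open>a\<close>, so such a
  clause ends before the next cut. \<open>Suc\<close> and the summand \<open>a\<close> force strict
  growth.\<close>

definition next_cut :: "nat \<Rightarrow> nat" where
  "next_cut a = Suc (a + (\<Sum>e<a. \<Sum>y<Suc (stage_bound a). \<Sum>i<N e. clause e y i))"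

text \<open>Indices are counted, repeated values included; the sum of indicators keeps the predicate
  within the computability rules.\<close>

definition heavy :: "nat \<Rightarrow> nat \<Rightarrow> nat \<Rightarrow> nat \<Rightarrow> bool" where
  "heavy e y a a' \<longleftrightarrow> active e y \<and>
    N e \<le> 2 * (\<Sum>i<N e. if a \<le> clause e y i \<and> clause e y i < a' then 1 else 0)"

text \<open>\<open>u\<close> codes a colouring, zero against nonzero. The bounds on \<open>e\<close>
  and \<open>y\<close> make this decidable and, by \<open>stage_le_bound\<close>, still admit every
  heavy clause with a value below \<open>a'\<close>.\<close>

definition good :: "nat \<Rightarrow> nat \<Rightarrow> nat \<Rightarrow> bool" where
  "good u a a' \<longleftrightarrow> (\<forall>e<a'. \<forall>y<Suc (stage_bound a'). heavy e y a a' \<longrightarrow>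
    (\<exists>i<N e. a \<le> clause e y i \<and> clause e y i < a' \<and> seq_nth u (clause e y i) = 0) \<and>
    (\<exists>i<N e. a \<le> clause e y i \<and> clause e y i < a' \<and> seq_nth u (clause e y i) \<noteq> 0))"

definition layer_colouring :: "nat \<Rightarrow> nat" where
  "layer_colouring a = (LEAST u. good u a (next_cut a))"

definition cutpoint :: "nat \<Rightarrow> nat" where "cutpoint k = (next_cut ^^ k) 0"

definition layer :: "nat \<Rightarrow> nat" where "layer j = (LEAST k. j < cutpoint (Suc k))"

definition colour :: "nat \<Rightarrow> nat" where
  "colour j = (if seq_nth (layer_colouring (cutpoint (layer j))) j = 0 then 0 else 1)"

section \<open>Monotone guesses; bounds and multiplicities of clauses\<close>

lemma guess_ex: "\<exists>w. s \<le> w \<or> (valid e w \<and> survives e w s)"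
  by auto

text \<open>A later stage only removes candidates from the search.\<close>

lemma guess_mono:
  assumes "s \<le> s'" shows "guess e s \<le> guess e s'"
proof -
  have "s' \<le> guess e s' \<or> (valid e (guess e s') \<and> survives e (guess e s') s')"
    unfolding guess_def by (rule LeastI_ex[OF guess_ex])
  then show ?thesis
    unfolding guess_def[of e s] using assms by (intro Least_le) (auto simp: survives_def)
qed

lemma guess_start: "guess e (start e y) = guess e y"
  unfolding start_def by (rule LeastI) simp

lemma clause_eq: "active e y \<Longrightarrow> i < N e \<Longrightarrow> clause e y i = f {elt (guess e y) i, y}"
  by (auto simp: active_def clause_def intro: F_eq)

lemma clause_gt: "active e y \<Longrightarrow> i < N e \<Longrightarrow> used e (start e y) < clause e y i"
  using clause_eq[of e y i] g_bound by (metis active_def)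

text \<open>This is the purpose of the summand \<open>s + e\<close> in \<open>used\<close>.\<close>

lemma clause_gt_index: "active e y \<Longrightarrow> i < N e \<Longrightarrow> e < clause e y i"
  and clause_gt_start: "active e y \<Longrightarrow> i < N e \<Longrightarrow> start e y < clause e y i"
  using clause_gt[of e y i] by (simp_all add: used_def)

lemma le_used:
  assumes "t < s" "i < N e" shows "F (elt (guess e t) i) t \<le> used e s"
proof -
  have "F (elt (guess e t) i) t \<le> (\<Sum>i<N e. F (elt (guess e t) i) t)"
    using assms(2) by (intro member_le_sum) auto
  also have "\<dots> \<le> (\<Sum>t<s. \<Sum>i<N e. F (elt (guess e t) i) t)"
    using assms(1) by (intro member_le_sum[of t]) auto
  finally show ?thesis by (simp add: used_def)
qed

text \<open>The smaller of two guesses was held before the larger one started. Its value is then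
  counted in \<open>used\<close> at that start, below every value of the later clause.\<close>

lemma common_value_same_guess:
  assumes "active e y" "active e y'" "i < N e" "i' < N e" "clause e y i = clause e y' i'"
  shows "guess e y = guess e y'"
proof -
  have *: "\<not> guess e t < guess e t'" if "active e t" "active e t'" "j < N e" "j' < N e"
    "clause e t j = clause e t' j'" for t t' j j'
  proof
    assume lt: "guess e t < guess e t'"
    have "t < start e t'"
    proof (rule ccontr)
      assume "\<not> t < start e t'"
      then have "guess e (start e t') \<le> guess e t" by (intro guess_mono) simp
      with lt show False by (simp add: guess_start)
    qed
    then have "clause e t j \<le> used e (start e t')"
      unfolding clause_def by (rule le_used) fact
    with clause_gt[of e t' j'] that show False by simp
  qed
  show ?thesis using *[of y y' i i'] *[of y' y i' i] assms by (simp add: not_less)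
qed

text \<open>For \<open>y\<close> beyond \<open>g x j\<close> the value \<open>f {x, y}\<close> would
  exceed \<open>j\<close>.\<close>

lemma stage_le_bound:
  assumes "active e y" "i < N e" "clause e y i < a"
  shows "y \<le> stage_bound a" and "e < a"
proof -
  show ea: "e < a" using clause_gt_index[OF assms(1,2)] assms(3) by simp
  have sa: "start e y < a" using clause_gt_start[OF assms(1,2)] assms(3) by simp
  let ?j = "clause e y i" and ?x = "elt (guess e y) i"
  have "y \<le> g ?x ?j"
  proof (rule ccontr)
    assume "\<not> y \<le> g ?x ?j"
    moreover have "y \<noteq> ?x" using assms(1,2) by (auto simp: active_def)
    ultimately have "?j < f {?x, y}" by (intro g_bound) auto
    with clause_eq[OF assms(1,2)] show False by simp
  qed
  \<comment> \<open>The stage \<open>y\<close> has no bound yet, but its guess was already present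
    at \<open>start e y < a\<close>, within the range of the sum.\<close>
  also have "\<dots> = g (elt (guess e (start e y)) i) ?j" by (simp add: guess_start)
  also have "\<dots> \<le> (\<Sum>j<a. g (elt (guess e (start e y)) i) j)"
    using assms(3) by (intro member_le_sum) auto
  also have "\<dots> \<le> (\<Sum>i<N e. \<Sum>j<a. g (elt (guess e (start e y)) i) j)"
    using assms(2) by (intro member_le_sum[of i]) auto
  also have "\<dots> \<le> (\<Sum>s<a. \<Sum>i<N e. \<Sum>j<a. g (elt (guess e s) i) j)"
    using sa by (intro member_le_sum[of "start e y"]) auto
  also have "\<dots> \<le> stage_bound a"
    unfolding stage_bound_def using ea by (intro member_le_sum[of e]) auto
  finally show "y \<le> stage_bound a" .
qed

lemma next_cut_gt: "a < next_cut a"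
  by (simp add: next_cut_def)

lemma clause_less_next_cut:
  assumes "active e y" "i < N e" "clause e y i < a" "i' < N e"
  shows "clause e y i' < next_cut a"
proof -
  note bounds = stage_le_bound[OF assms(1-3)]
  have "clause e y i' \<le> (\<Sum>i<N e. clause e y i)"
    using assms(4) by (intro member_le_sum) auto
  also have "\<dots> \<le> (\<Sum>y<Suc (stage_bound a). \<Sum>i<N e. clause e y i)"
    using bounds(1) by (intro member_le_sum[of y]) auto
  also have "\<dots> \<le> (\<Sum>e<a. \<Sum>y<Suc (stage_bound a). \<Sum>i<N e. clause e y i)"
    using bounds(2) by (intro member_le_sum[of e]) auto
  finally show ?thesis by (simp add: next_cut_def)
qed

lemma elt_inj: "active e y \<Longrightarrow> inj_on (elt (guess e y)) {..<N e}"
  unfolding active_def valid_def inj_on_def by (metis lessThan_iff nat_neq_iff)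

text \<open>The guessed elements are distinct, so the indices inject into a fibre of
  \<open>f\<close> based at \<open>y\<close>.\<close>

lemma card_clause_fibre:
  assumes "active e y"
  shows "card {i \<in> {..<N e}. clause e y i = v} \<le> b"
proof (cases "{i \<in> {..<N e}. clause e y i = v} = {}")
  case False
  then obtain i0 where i0: "i0 < N e" "clause e y i0 = v" by auto
  let ?x = "elt (guess e y)"
  let ?Z = "{z. z \<noteq> y \<and> f {y, z} = f {y, ?x i0}}"
  have Z: "finite ?Z" "card ?Z \<le> b"
    using fibre[of y "?x i0"] i0(1) assms by (auto simp: active_def)
  have "?x ` {i \<in> {..<N e}. clause e y i = v} \<subseteq> ?Z"
  proof
    fix z assume "z \<in> ?x ` {i \<in> {..<N e}. clause e y i = v}"
    then obtain i where i: "i < N e" "clause e y i = v" "z = ?x i" by auto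
    have "f {?x i, y} = f {?x i0, y}"
      using clause_eq[OF assms i(1)] clause_eq[OF assms i0(1)] i i0 by simp
    moreover have "?x i \<noteq> y" using i(1) assms by (auto simp: active_def)
    ultimately show "z \<in> ?Z" by (simp add: i(3) insert_commute)
  qed
  moreover have "inj_on ?x {i \<in> {..<N e}. clause e y i = v}"
    using elt_inj[OF assms] by (rule inj_on_subset) auto
  ultimately have "card {i \<in> {..<N e}. clause e y i = v} \<le> card ?Z"
    using Z(1) by (intro card_inj_on_le) auto
  with Z(2) show ?thesis by simp
next
  case True
  show ?thesis unfolding True by simp
qed

text \<open>At least \<open>b * (K + 4 * e)\<close> indices fall into the interval, and no value is
  taken more than \<open>b\<close> times.\<close>

lemma card_heavy:
  assumes "heavy e y a a'"
  shows "K + 4 * e \<le> card (clause e y ` {..<N e} \<inter> {a..<a'})"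
proof -
  let ?T = "clause e y ` {..<N e} \<inter> {a..<a'}"
  have act: "active e y" using assms by (simp add: heavy_def)
  have "(\<Sum>i<N e. if a \<le> clause e y i \<and> clause e y i < a' then 1 else 0) =
      card {i \<in> {..<N e}. a \<le> clause e y i \<and> clause e y i < a'}"
    by (simp add: sum.If_cases Int_def)
  also have "{i \<in> {..<N e}. a \<le> clause e y i \<and> clause e y i < a'} = {i \<in> {..<N e}. clause e y i \<in> ?T}"
    by auto
  also have "card \<dots> \<le> b * card ?T"
    by (rule card_fibres_le) (auto intro: card_clause_fibre[OF act, unfolded lessThan_iff])
  finally have "N e \<le> 2 * (b * card ?T)" using assms unfolding heavy_def by linarith
  then show ?thesis using b_pos by (simp add: N_def mult.assoc)
qed

text \<open>All these clauses stem from one guess, so every such stage lies in a fibre based at one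
  of \<open>N e\<close> fixed elements.\<close>

lemma card_clauses_through:
  fixes v :: nat
  assumes "finite Y" "\<And>y. y \<in> Y \<Longrightarrow> active e y \<and> v \<in> clause e y ` {..<N e}"
  shows "card Y \<le> N e * b"
proof (cases "Y = {}")
  case False
  then obtain y0 where y0: "y0 \<in> Y" by auto
  let ?x = "elt (guess e y0)"
  let ?Z = "\<lambda>i. {z. z \<noteq> ?x i \<and> f {?x i, z} = v}"
  have Z: "finite (?Z i) \<and> card (?Z i) \<le> b" for i
  proof (cases "?Z i = {}")
    case True
    then show ?thesis by (simp only: finite.emptyI card.empty) simp
  next
    case False
    then obtain z where "z \<noteq> ?x i" "f {?x i, z} = v" by auto
    with fibre[of "?x i" z] show ?thesis by simp
  qed
  have "Y \<subseteq> (\<Union>i\<in>{..<N e}. ?Z i)"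
  proof
    fix y assume y: "y \<in> Y"
    obtain i0 where i0: "i0 < N e" "clause e y0 i0 = v" using assms(2)[OF y0] by auto
    obtain i where i: "i < N e" "clause e y i = v" using assms(2)[OF y] by auto
    have act: "active e y" using assms(2)[OF y] ..
    have "guess e y = guess e y0"
      using assms(2)[OF y0] act i i0 by (intro common_value_same_guess[of e y y0 i i0]) auto
    then have "f {?x i, y} = v" "?x i \<noteq> y"
      using clause_eq[OF act i(1)] act i by (auto simp: active_def)
    then show "y \<in> (\<Union>i\<in>{..<N e}. ?Z i)" using i(1) by auto
  qed
  then have "card Y \<le> card (\<Union>i\<in>{..<N e}. ?Z i)"
    using Z by (intro card_mono) auto
  also have "\<dots> \<le> (\<Sum>i\<in>{..<N e}. card (?Z i))" by (rule card_UN_le) simp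
  also have "\<dots> \<le> (\<Sum>i\<in>{..<N e}. b)" using Z by (intro sum_mono) simp
  finally show ?thesis by simp
qed simp

text \<open>The heavy clauses, cut down to the interval, form a finite hypergraph. Grouped by index,
  the weights through one number add up to at most the sum of \<open>(1/8) * (1/2) ^ e\<close>,
  hence to at most 1/4.\<close>

lemma ex_good: "\<exists>u. good u a a'"
proof -
  define I where "I = {(e, y). e < a' \<and> y < Suc (stage_bound a') \<and> heavy e y a a'}"
  define A where "A = (\<lambda>(e, y). clause e y ` {..<N e} \<inter> {a..<a'})"
  define Y where "Y v e = {y. (e, y) \<in> I \<and> v \<in> A (e, y)}" for v e
  have finI: "finite I"
    by (rule finite_subset[of _ "{..<a'} \<times> {..<Suc (stage_bound a')}"]) (auto simp: I_def)
  have finY: "finite (Y v e)" for v e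
    by (rule finite_subset[of _ "{..<Suc (stage_bound a')}"]) (auto simp: Y_def I_def)
  have "\<exists>c :: nat \<Rightarrow> bool. \<forall>i\<in>I. (\<exists>j\<in>A i. c j) \<and> (\<exists>j\<in>A i. \<not> c j)"
  proof (rule ex_no_monochromatic[OF finI])
    show "finite {a..<a'}" by simp
    show "A i \<subseteq> {a..<a'}" for i by (auto simp: A_def)
    show "A i \<noteq> {}" if "i \<in> I" for i
    proof -
      obtain e y where "i = (e, y)" by (cases i)
      with that card_heavy[of e y a a'] K_ge have "0 < card (A i)" by (auto simp: I_def A_def)
      then show ?thesis by auto
    qed
  next
    fix v
    have "(\<Sum>i | i \<in> I \<and> v \<in> A i. (2/3::real) ^ (card (A i) - 1)) =
        (\<Sum>(e, y) \<in> Sigma {..<a'} (Y v). (2/3) ^ (card (A (e, y)) - 1))"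
    proof -
      have "{i. i \<in> I \<and> v \<in> A i} = Sigma {..<a'} (Y v)" by (auto simp: Y_def I_def)
      then show ?thesis by (simp add: case_prod_unfold)
    qed
    also have "\<dots> = (\<Sum>e<a'. \<Sum>y\<in>Y v e. (2/3) ^ (card (A (e, y)) - 1))"
      using finY by (intro sum.Sigma[symmetric]) auto
    also have "\<dots> \<le> (\<Sum>e<a'. \<Sum>y\<in>Y v e. (2/3) ^ (K + 4 * e - 1))"
    proof (intro sum_mono power_decreasing)
      fix e y assume "y \<in> Y v e"
      then have "K + 4 * e \<le> card (A (e, y))"
        using card_heavy[of e y a a'] by (auto simp: Y_def I_def A_def)
      then show "K + 4 * e - 1 \<le> card (A (e, y)) - 1" by simp
    qed auto
    also have "\<dots> = (\<Sum>e<a'. real (card (Y v e)) * (2/3) ^ (K + 4 * e - 1))" by simp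
    also have "\<dots> \<le> (\<Sum>e<a'. real (N e * b) * (2/3) ^ (K + 4 * e - 1))"
    proof (intro sum_mono mult_right_mono)
      fix e
      have "card (Y v e) \<le> N e * b"
        by (rule card_clauses_through[where v = v])
          (auto simp: finY, auto simp: Y_def I_def A_def heavy_def)
      then show "real (card (Y v e)) \<le> real (N e * b)" by (rule of_nat_mono)
    qed auto
    also have "\<dots> \<le> (\<Sum>e<a'. (1/8) * (1/2) ^ e)"
      unfolding N_def by (intro sum_mono weight)
    also have "\<dots> = (1/8) * (\<Sum>e<a'. (1/2) ^ e)" by (simp add: sum_distrib_left)
    also have "(\<Sum>e<a'. (1/2::real) ^ e) \<le> 2" by (simp add: geometric_sum)
    finally show "(\<Sum>i | i \<in> I \<and> v \<in> A i. (2/3::real) ^ (card (A i) - 1)) \<le> 1/4" by simp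
  qed
  then obtain c :: "nat \<Rightarrow> bool"
    where c: "\<And>i. i \<in> I \<Longrightarrow> (\<exists>j\<in>A i. c j) \<and> (\<exists>j\<in>A i. \<not> c j)" by blast
  obtain u where u: "\<And>j. j < a' \<Longrightarrow> seq_nth u j = (if c j then 0 else 1)"
    using ex_seq_nth[of a' "\<lambda>j. if c j then 0 else 1"] by auto
  have "good u a a'"
    unfolding good_def
  proof (intro allI impI)
    fix e y assume "e < a'" "y < Suc (stage_bound a')" "heavy e y a a'"
    then have "(e, y) \<in> I" by (simp add: I_def)
    from c[OF this] obtain i i' where "i < N e" "i' < N e" "a \<le> clause e y i" "clause e y i < a'"
      "a \<le> clause e y i'" "clause e y i' < a'" "c (clause e y i)" "\<not> c (clause e y i')"
      by (auto simp: A_def)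
    then show "(\<exists>i<N e. a \<le> clause e y i \<and> clause e y i < a' \<and> seq_nth u (clause e y i) = 0) \<and>
      (\<exists>i<N e. a \<le> clause e y i \<and> clause e y i < a' \<and> seq_nth u (clause e y i) \<noteq> 0)"
      using u by (metis zero_neq_one)
  qed
  then show ?thesis ..
qed

section \<open>Layers, and both colours on every active clause\<close>

lemma cutpoint_Suc: "cutpoint (Suc k) = next_cut (cutpoint k)"
  by (simp add: cutpoint_def)

lemma strict_mono_cutpoint: "strict_mono cutpoint"
  by (rule strict_mono_Suc_iff[THEN iffD2]) (simp add: cutpoint_Suc next_cut_gt)

lemma cutpoint_ex: "\<exists>k. j < cutpoint (Suc k)"
  using strict_mono_imp_increasing[OF strict_mono_cutpoint, of "Suc j"] by (intro exI[of _ j]) simp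

lemma layer_bounds: "cutpoint (layer j) \<le> j" "j < cutpoint (Suc (layer j))"
proof -
  show "j < cutpoint (Suc (layer j))" unfolding layer_def by (rule LeastI_ex[OF cutpoint_ex])
  show "cutpoint (layer j) \<le> j"
  proof (cases "layer j")
    case (Suc k)
    then have "\<not> j < cutpoint (Suc k)" unfolding layer_def by (intro not_less_Least) simp
    with Suc show ?thesis by simp
  qed (simp add: cutpoint_def)
qed

lemma layer_eqI:
  assumes "cutpoint k \<le> j" "j < cutpoint (Suc k)" shows "layer j = k"
proof (rule antisym)
  show "layer j \<le> k" unfolding layer_def using assms(2) by (rule Least_le)
  have "cutpoint k < cutpoint (Suc (layer j))" using assms(1) layer_bounds(2)[of j] by simp
  then show "k \<le> layer j" using strict_mono_less[OF strict_mono_cutpoint] by simp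
qed

lemma heavy_not_monochromatic:
  assumes "heavy e y (cutpoint k) (cutpoint (Suc k))"
  shows "(\<exists>i<N e. colour (clause e y i) = 0) \<and> (\<exists>i<N e. colour (clause e y i) = 1)"
proof -
  have act: "active e y" using assms by (simp add: heavy_def)
  \<comment> \<open>A heavy clause really has a value in the layer since \<open>N e > 0\<close>;
    through it \<open>stage_le_bound\<close> brings \<open>e\<close> and \<open>y\<close> within the
    bounds of \<open>good\<close>.\<close>
  have "{..<N e} \<inter> {i. cutpoint k \<le> clause e y i \<and> clause e y i < cutpoint (Suc k)} \<noteq> {}"
    using assms N_pos[of e] by (auto simp: heavy_def sum.If_cases)
  then obtain i where i: "i < N e" "clause e y i < cutpoint (Suc k)" by auto
  have "good (layer_colouring (cutpoint k)) (cutpoint k) (cutpoint (Suc k))"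
    unfolding layer_colouring_def cutpoint_Suc by (rule LeastI_ex[OF ex_good])
  then obtain i0 i1 where i01: "i0 < N e" "cutpoint k \<le> clause e y i0" "clause e y i0 < cutpoint (Suc k)"
      "seq_nth (layer_colouring (cutpoint k)) (clause e y i0) = 0"
    "i1 < N e" "cutpoint k \<le> clause e y i1" "clause e y i1 < cutpoint (Suc k)"
      "seq_nth (layer_colouring (cutpoint k)) (clause e y i1) \<noteq> 0"
    unfolding good_def using assms stage_le_bound[OF act i] by (meson le_imp_less_Suc)
  then have "layer (clause e y i0) = k" "layer (clause e y i1) = k"
    by (auto intro: layer_eqI)
  with i01 have "colour (clause e y i0) = 0" "colour (clause e y i1) = 1"
    unfolding colour_def by auto
  with i01 show ?thesis by blast
qed

text \<open>Let \<open>k\<close> be the layer of the least value. The choice of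
  \<open>next_cut\<close> confines the clause to layers \<open>k\<close> and \<open>Suc k\<close>,
  and one of them receives half of the indices.\<close>

lemma active_not_monochromatic:
  assumes act: "active e y"
  shows "(\<exists>i<N e. colour (clause e y i) = 0) \<and> (\<exists>i<N e. colour (clause e y i) = 1)"
proof -
  define v where "v = Min (clause e y ` {..<N e})"
  have "v \<in> clause e y ` {..<N e}" unfolding v_def using N_pos by (intro Min_in) auto
  then obtain i0 where i0: "i0 < N e" "clause e y i0 = v" by auto
  have ge: "v \<le> clause e y i" if "i < N e" for i
    unfolding v_def using that by (intro Min_le) auto
  define k where "k = layer v"
  have lo: "cutpoint k \<le> clause e y i" if "i < N e" for i
    using ge[OF that] layer_bounds(1)[of v] by (simp add: k_def)
  have hi: "clause e y i < cutpoint (Suc (Suc k))" if "i < N e" for i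
    unfolding cutpoint_Suc[of "Suc k"]
    using clause_less_next_cut[OF act i0(1) _ that] layer_bounds(2)[of v] i0 by (simp add: k_def)
  let ?c = "\<lambda>k. \<Sum>i<N e. if cutpoint k \<le> clause e y i \<and> clause e y i < cutpoint (Suc k) then 1 else 0 :: nat"
  have "?c k + ?c (Suc k) = (\<Sum>i<N e. 1)"
    unfolding sum.distrib[symmetric] by (rule sum.cong) (use lo hi in \<open>auto simp: not_less\<close>)
  then have "N e \<le> 2 * ?c k \<or> N e \<le> 2 * ?c (Suc k)" by auto
  then have "heavy e y (cutpoint k) (cutpoint (Suc k)) \<or> heavy e y (cutpoint (Suc k)) (cutpoint (Suc (Suc k)))"
    using act unfolding heavy_def by blast
  then show ?thesis using heavy_not_monochromatic by blast
qed

section \<open>Convergence of the guesses and the diagonal argument\<close>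

lemma guess_converges:
  assumes true: "valid e w" "\<And>i t. i < N e \<Longrightarrow> \<not> refutes e (elt w i) (wit w i) t"
  shows "\<exists>w s0. valid e w \<and> (\<forall>i<N e. \<forall>t. \<not> refutes e (elt w i) (wit w i) t) \<and>
    (\<forall>s\<ge>s0. guess e s = w)"
proof -
  let ?P = "\<lambda>w. valid e w \<and> (\<forall>i<N e. \<forall>t. \<not> refutes e (elt w i) (wit w i) t)"
  define w0 where "w0 = (LEAST w. ?P w)"
  have w0: "?P w0" unfolding w0_def by (rule LeastI[of ?P w]) (use true in blast)
  \<comment> \<open>Every candidate below the least correct one is eventually discarded, so the
    search settles on \<open>w0\<close>.\<close>
  have "\<exists>t. \<forall>s>t. \<not> (valid e w \<and> survives e w s)" if "w < w0" for w
  proof -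
    have "\<not> ?P w" using that unfolding w0_def by (rule not_less_Least)
    then show ?thesis unfolding survives_def by blast
  qed
  then obtain T where T: "\<And>w s. w < w0 \<Longrightarrow> T w < s \<Longrightarrow> \<not> (valid e w \<and> survives e w s)"
    by metis
  \<comment> \<open>Including \<open>w0\<close> prevents the alternative \<open>s \<le> w\<close>
    from stopping the search below \<open>w0\<close>.\<close>
  define s0 where "s0 = Suc (w0 + (\<Sum>w<w0. T w))"
  have "guess e s = w0" if s: "s0 \<le> s" for s
    unfolding guess_def
  proof (rule Least_equality)
    show "s \<le> w0 \<or> valid e w0 \<and> survives e w0 s" using w0 by (auto simp: survives_def)
  next
    fix w assume w: "s \<le> w \<or> valid e w \<and> survives e w s"
    show "w0 \<le> w"
    proof (rule ccontr)
      assume "\<not> w0 \<le> w"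
      then have lt: "w < w0" by simp
      then have "T w \<le> (\<Sum>w<w0. T w)" by (intro member_le_sum) auto
      with s have "T w < s" by (simp add: s0_def)
      with T[OF lt] w have "s \<le> w" by blast
      with lt s show False by (simp add: s0_def)
    qed
  qed
  with w0 show ?thesis by blast
qed

lemma no_Sigma02_solution:
  assumes "Sigma02 H" "RT2_solution f colour H"
  shows False
proof -
  obtain R where R: "computable_rel3 R" and H: "H = {x. \<exists>a. \<forall>b. R x a b}"
    using assms(1) by (auto simp: Sigma02_def)
  obtain e where e: "\<And>x a. (\<exists>t. refutes e x a t) \<longleftrightarrow> (\<exists>b. \<not> R x a b)"
    using computable_rel3_ex_refutes[OF R] by blast
  have infH: "infinite H" and mono: "\<And>s t. s \<in> [H]\<^bsup>2\<^esup> \<Longrightarrow> t \<in> [H]\<^bsup>2\<^esup> \<Longrightarrow> colour (f s) = colour (f t)"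
    using assms(2) unfolding RT2_solution_def by blast+
  have in_H: "x \<in> H \<longleftrightarrow> (\<exists>a. \<forall>t. \<not> refutes e x a t)" for x
    unfolding H using e by blast
  obtain a where a: "\<And>x t. x \<in> H \<Longrightarrow> \<not> refutes e x (a x) t"
    using in_H by metis
  \<comment> \<open>The first \<open>N e\<close> elements of \<open>H\<close> with true witnesses
    show that a correct candidate exists.\<close>
  obtain w where w: "\<And>i. i < N e \<Longrightarrow> seq_nth w i = pr (enumerate H i) (a (enumerate H i))"
    using ex_seq_nth[of "N e" "\<lambda>i. pr (enumerate H i) (a (enumerate H i))"] by auto
  have "valid e w"
    unfolding valid_def elt_def
  proof (intro allI impI)
    fix i j assume ij: "i < N e" "j < i"
    then have "enumerate H j < enumerate H i" by (intro enumerate_mono infH)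
    then show "p1 (seq_nth w i) \<noteq> p1 (seq_nth w j)" using ij w by simp
  qed
  moreover have "\<not> refutes e (elt w i) (wit w i) t" if "i < N e" for i t
    using w[OF that] a enumerate_in_set[OF infH] by (simp add: elt_def wit_def)
  ultimately have "\<exists>w s0. valid e w \<and> (\<forall>i<N e. \<forall>t. \<not> refutes e (elt w i) (wit w i) t) \<and>
      (\<forall>s\<ge>s0. guess e s = w)"
    by (rule guess_converges)
  then obtain w s0 where val: "valid e w"
    and true: "\<And>i t. i < N e \<Longrightarrow> \<not> refutes e (elt w i) (wit w i) t"
    and conv: "\<And>s. s0 \<le> s \<Longrightarrow> guess e s = w"
    by blast
  \<comment> \<open>The limit may be another sequence, but its unrefuted witnesses still place its
    elements in \<open>H\<close>.\<close>
  have eltH: "elt w i \<in> H" if "i < N e" for i using true[OF that] in_H by blast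
  \<comment> \<open>\<open>start\<close> depends on the stage only through the guess, so
    \<open>J\<close> is the activation threshold for every late \<open>y\<close> and is available
    before \<open>y\<close> is chosen.\<close>
  define J where "J = used e (start e s0)"
  define y0 where "y0 = s0 + (\<Sum>i<N e. elt w i + g (elt w i) J)"
  obtain y where y: "y \<in> H" "y0 < y" using infH by (meson infinite_nat_iff_unbounded)
  have guess_y: "guess e y = w" using conv[of y] y by (simp add: y0_def)
  have start_y: "used e (start e y) = J"
    using conv[of s0] guess_y by (simp add: J_def start_def)
  have lt: "elt w i < y \<and> g (elt w i) J < y" if "i < N e" for i
  proof -
    have "elt w i + g (elt w i) J \<le> (\<Sum>i<N e. elt w i + g (elt w i) J)"
      using that by (intro member_le_sum) auto
    with y(2) show ?thesis by (simp add: y0_def)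
  qed
  have act: "active e y"
    unfolding active_def guess_y start_y using val lt by auto
  have pairs: "{elt w i, y} \<in> [H]\<^bsup>2\<^esup>" if "i < N e" for i
    using eltH[OF that] lt[OF that] y(1) by (auto simp: nsets_def)
  have same: "colour (clause e y i) = colour (clause e y j)" if "i < N e" "j < N e" for i j
    unfolding clause_eq[OF act that(1)] clause_eq[OF act that(2)] guess_y
    using pairs that by (intro mono)
  from active_not_monochromatic[OF act] obtain i j where "i < N e" "j < N e"
    "colour (clause e y i) = 0" "colour (clause e y j) = 1" by auto
  with same[of i j] show False by simp
qed

section \<open>Computability of the colouring\<close>

lemma computable1_N: "computable1 N"
  unfolding N_def[abs_def] by (intro comp_intros)

lemma computable_elt: "computable1 h \<Longrightarrow> computable1 i \<Longrightarrow> computable1 (\<lambda>x. elt (h x) (i x))"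
  unfolding elt_def by (intro comp_intros)

lemma computable_wit: "computable1 h \<Longrightarrow> computable1 i \<Longrightarrow> computable1 (\<lambda>x. wit (h x) (i x))"
  unfolding wit_def by (intro comp_intros)

lemmas base_intros = comp_intros computable1_comp[OF computable1_N] computable_elt computable_wit
  decidable_refutes computable2_comp[OF F] computable2_comp[OF g]

lemma computable_guess: "computable1 h \<Longrightarrow> computable1 i \<Longrightarrow> computable1 (\<lambda>x. guess (h x) (i x))"
proof (rule computable_curry2[of guess])
  show "computable1 (\<lambda>p. guess (p1 p) (p2 p))"
    unfolding guess_def valid_def survives_def by (intro base_intros) auto
qed

lemma computable_start: "computable1 h \<Longrightarrow> computable1 i \<Longrightarrow> computable1 (\<lambda>x. start (h x) (i x))"
proof (rule computable_curry2[of start])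
  show "computable1 (\<lambda>p. start (p1 p) (p2 p))"
    unfolding start_def by (intro base_intros computable_guess) auto
qed

lemma computable_used: "computable1 h \<Longrightarrow> computable1 i \<Longrightarrow> computable1 (\<lambda>x. used (h x) (i x))"
proof (rule computable_curry2[of used])
  show "computable1 (\<lambda>p. used (p1 p) (p2 p))"
    unfolding used_def by (intro base_intros computable_guess)
qed

lemma decidable_active:
  assumes "computable1 h" "computable1 i" shows "decidable (\<lambda>x. active (h x) (i x))"
proof -
  have "decidable (\<lambda>p. active (p1 p) (p2 p))"
    unfolding active_def valid_def
    by (intro base_intros computable_guess computable_start computable_used)
  then show ?thesis
    using computable_curry2[of "\<lambda>a c. if active a c then 1 else 0"] assms
    unfolding decidable_def by blast
qed

lemma computable_clause:
  "computable1 h \<Longrightarrow> computable1 i \<Longrightarrow> computable1 k \<Longrightarrow> computable1 (\<lambda>x. clause (h x) (i x) (k x))"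
  unfolding clause_def by (intro base_intros computable_guess)

lemma computable_stage_bound: "computable1 h \<Longrightarrow> computable1 (\<lambda>x. stage_bound (h x))"
proof (rule computable1_comp[of stage_bound])
  show "computable1 stage_bound"
    unfolding stage_bound_def[abs_def] by (intro base_intros computable_guess)
qed

lemma computable1_next_cut: "computable1 next_cut"
  unfolding next_cut_def[abs_def]
  by (intro base_intros computable_clause computable_stage_bound)

text \<open>Each layer is coloured by a decidable search, which terminates by the counting argument
  behind \<open>ex_good\<close>.\<close>

lemma computable1_layer_colouring: "computable1 layer_colouring"
  unfolding layer_colouring_def[abs_def] good_def heavy_def
  by (intro base_intros computable_clause computable_stage_bound decidable_active
      computable1_comp[OF computable1_next_cut])
    (use ex_good in \<open>simp add: good_def heavy_def\<close>)

lemma computable1_cutpoint: "computable1 cutpoint"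
  unfolding cutpoint_def[abs_def] by (intro base_intros computable1_next_cut)

lemma computable1_layer: "computable1 layer"
  unfolding layer_def[abs_def]
  by (intro base_intros computable1_comp[OF computable1_cutpoint] cutpoint_ex)

lemma computable1_colour: "computable1 colour"
  unfolding colour_def[abs_def]
  by (intro base_intros computable1_comp[OF computable1_layer_colouring]
      computable1_comp[OF computable1_cutpoint] computable1_comp[OF computable1_layer])

end

theorem corollary3p4:
  fixes f :: "nat set \<Rightarrow> nat"
  assumes "addition_like f"
  shows "\<exists>c. RT2_instance c \<and> computable1 c \<and>
    \<not> (\<exists>H. Sigma02 H \<and> RT2_solution f c H)"
proof -
  obtain F where F: "computable2 F" "\<And>x y. x \<noteq> y \<Longrightarrow> F x y = f {x, y}"
    using assms by (auto simp: addition_like_def computable_on_pairs_def)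
  obtain g where g: "computable2 g" "\<And>x y n. g x n < y \<Longrightarrow> y \<noteq> x \<Longrightarrow> n < f {x, y}"
    using assms by (auto simp: addition_like_def)
  obtain b where b: "\<And>x y. x \<noteq> y \<Longrightarrow> finite {z. z \<noteq> x \<and> f {x, z} = f {x, y}} \<and>
      card {z. z \<noteq> x \<and> f {x, z} = f {x, y}} \<le> b"
    using assms by (auto simp: addition_like_def)
  \<comment> \<open>The fibre contains \<open>Suc 0\<close> itself, so its bound \<open>b\<close> is
    positive.\<close>
  have "0 < card {z. z \<noteq> 0 \<and> f {0, z} = f {0, Suc 0}}"
    using b[of 0 "Suc 0"] by (subst card_gt_0_iff) auto
  then have "0 < b" using b[of 0 "Suc 0"] by simp
  moreover obtain K where "4 \<le> K"
    "\<And>e. real (2 * b * (K + 4 * e) * b) * (2/3) ^ (K + 4 * e - 1) \<le> (1/8) * (1/2) ^ e"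
    using ex_weight_constant[of b] by blast
  ultimately interpret addition_like_function f F g b K
    using F g b by unfold_locales
  have "RT2_instance colour" by (auto simp: RT2_instance_def colour_def)
  then show ?thesis using computable1_colour no_Sigma02_solution by blast
qed

end
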